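(* Let $p,q\ge 2$ be integers and let $G$ be a finite simple semiregular graph with edge set $E$ and edge degree $p+q$, i.e. $G$ is a finite simple connected bipartite graph in which every edge connects a vertex of degree $p+1$ to a vertex of degree $q+1$. There is a constant $C_G>0$ depending only on $G$ such that for every function $f:E\to\mathbb{R}$ there is a number $\beta_{\max}\in\{(pq)^{-1/2}\}\cup[(pq)^{-1/4},1)$ such that both of the following hold with these same constants: (i) for every directed edge $a$ in $G$ and every integer $r\ge 0$, $\big|M_{r,a}(f)-\frac{1}{|E|}\sum_{e\in E}f(e)\big|\le C_G\|f\|_2\beta_{\max}^{\,r}$; (ii) for every (nonempty) finite connected subgraph $X$ of the universal covering tree $\widetilde G$ and every integer $r\ge 0$, $$\Big|\frac{1}{|\mathcal{T}'_r(X)|}\sum_{e\in\mathcal{T}'_r(X)}\tilde f(e)-\frac{1}{|E|}\sum_{e\in E}f(e)\Big|\le C_G\,\|f\|_2\,\beta_{\max}^{\,r}.$$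
   Context: Simple means no loops and no multiple edges. The edge degree of $e$ is the number of edges meeting $e$ in either of its endpoints. The norm is $\|f\|_2=\langle f,f\rangle^{1/2}$ with $\langle f,g\rangle=\sum_{e\in E}f(e)g(e)$. Universal cover: $\widetilde G$ is the universal covering tree of $G$, with vertex set $\widetilde V$ and edge set $\widetilde E$: fix a root vertex of $G$; the vertices of $\widetilde G$ are the non-backtracking paths in $G$ starting at the root, two being adjacent if they differ by exactly one edge at the end. The projection $\pi:\widetilde G\to G$ sends a path to its end vertex, and $\pi(\{\tilde v,\tilde w\})=\{\pi(\tilde v),\pi(\tilde w)\}$ on edges. The lift of $f$ is $\tilde f=f\circ\pi$. $\delta$ is the combinatorial distance between vertices. Edge spheres and arcs: for $v_0\in\widetilde V$, $S'_r(v_0)=\{e=\{x,y\}\in\widetilde E:\min\{\delta(x,v_0),\delta(y,v_0)\}=r\}$. For a directed edge $a$ of $\widetilde G$ from $w'$ to $w$, $A'_0(a)=\{a\}$ and $A'_{r+1}(a)=S'_{r+1}(w')\cap S'_r(w)$ for $r\ge0$, and $M_{r,a}(f)=\frac{1}{|A'_r(a)|}\sum_{x\in A'_r(a)}\tilde f(x)$. For a directed edge $a$ of $G$, $M_{r,a}(f)$ is computed using any lift of $a$ to $\widetilde G$ (the value does not depend on the lift). Tubes: for a finite connected subgraph $X$ of $\widetilde G$ with vertex set $V(X)$, the edge tube of radius $r$ around $X$ is $\mathcal{T}'_r(X)=\{e=\{x,y\}\in\widetilde E:\min_{z\in V(X)}\min\{\delta(x,z),\delta(y,z)\}=r\}$.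 The constant $C_G$ does not depend on $a$, $X$, $f$, $r$; the rate $\beta_{\max}$ may depend on $G$ and $f$ but not on $a$, $X$ or $r$. *)

theory Defs
  imports Complex_Main
begin

text \<open>A graph is a vertex set \<open>V\<close> with a set \<open>E\<close> of two-element subsets of \<open>V\<close>; in particular there
  are no loops and no multiple edges. The vertex set may be infinite, so that the universal covering
  tree is a graph in the same sense.\<close>

definition simple_graph :: "'a set \<Rightarrow> 'a set set \<Rightarrow> bool" where
  "simple_graph V E \<longleftrightarrow> (\<forall>e\<in>E. \<exists>x\<in>V. \<exists>y\<in>V. x \<noteq> y \<and> e = {x, y})"

definition walk :: "'a set \<Rightarrow> 'a set set \<Rightarrow> 'a list \<Rightarrow> bool" where
  "walk V E xs \<longleftrightarrow> xs \<noteq> [] \<and> set xs \<subseteq> V \<and> successively (\<lambda>x y. {x, y} \<in> E) xs"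

definition connected_graph :: "'a set \<Rightarrow> 'a set set \<Rightarrow> bool" where
  "connected_graph V E \<longleftrightarrow>
     V \<noteq> {} \<and> (\<forall>x\<in>V. \<forall>y\<in>V. \<exists>xs. walk V E xs \<and> hd xs = x \<and> last xs = y)"

definition vertex_degree :: "'a set set \<Rightarrow> 'a \<Rightarrow> nat" where
  "vertex_degree E v = card {e\<in>E. v \<in> e}"

definition bipartite_graph :: "'a set \<Rightarrow> 'a set set \<Rightarrow> bool" where
  "bipartite_graph V E \<longleftrightarrow>
     (\<exists>A B. A \<union> B = V \<and> A \<inter> B = {} \<and> (\<forall>e\<in>E. \<exists>x\<in>A. \<exists>y\<in>B. e = {x, y}))"

definition semiregular_graph :: "nat \<Rightarrow> nat \<Rightarrow> 'a set \<Rightarrow> 'a set set \<Rightarrow> bool" where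
  "semiregular_graph p q V E \<longleftrightarrow>
     finite V \<and> simple_graph V E \<and> connected_graph V E \<and> bipartite_graph V E \<and>
     (\<forall>e\<in>E. \<exists>x y. e = {x, y} \<and> vertex_degree E x = p + 1 \<and> vertex_degree E y = q + 1)"

text \<open>Meaningful when \<open>x\<close> and \<open>y\<close> are joined by a walk, as is always the case in a connected graph.\<close>

definition graph_dist :: "'a set \<Rightarrow> 'a set set \<Rightarrow> 'a \<Rightarrow> 'a \<Rightarrow> nat" where
  "graph_dist V E x y =
     (LEAST n. \<exists>xs. walk V E xs \<and> hd xs = x \<and> last xs = y \<and> length xs = n + 1)"

definition subgraph :: "'a set \<Rightarrow> 'a set set \<Rightarrow> 'a set \<Rightarrow> 'a set set \<Rightarrow> bool" where
  "subgraph W F V E \<longleftrightarrow> W \<subseteq> V \<and> F \<subseteq> E \<and> simple_graph W F"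


text \<open>The vertices of the universal covering tree are the non-backtracking walks (recorded by their
  vertex lists) starting at the root \<open>o\<^sub>G\<close>. The covering projection is \<^const>\<open>last\<close> on vertices, hence
  \<^term>\<open>image last\<close> on edges.\<close>

definition non_backtracking :: "'a list \<Rightarrow> bool" where
  "non_backtracking xs \<longleftrightarrow> (\<forall>i. i + 2 < length xs \<longrightarrow> xs ! i \<noteq> xs ! (i + 2))"

definition cover_verts :: "'a set \<Rightarrow> 'a set set \<Rightarrow> 'a \<Rightarrow> 'a list set" where
  "cover_verts V E o\<^sub>G = {xs. walk V E xs \<and> hd xs = o\<^sub>G \<and> non_backtracking xs}"

definition cover_edges :: "'a set \<Rightarrow> 'a set set \<Rightarrow> 'a \<Rightarrow> 'a list set set" where
  "cover_edges V E o\<^sub>G =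
     {{xs, xs @ [v]} | xs v. xs \<in> cover_verts V E o\<^sub>G \<and> xs @ [v] \<in> cover_verts V E o\<^sub>G}"

definition lift :: "('a set \<Rightarrow> real) \<Rightarrow> 'a list set \<Rightarrow> real" where
  "lift f = (\<lambda>e. f (last ` e))"


definition edge_sphere :: "'a set \<Rightarrow> 'a set set \<Rightarrow> nat \<Rightarrow> 'a \<Rightarrow> 'a set set" where
  "edge_sphere V E r v =
     {{x, y} | x y. {x, y} \<in> E \<and> min (graph_dist V E x v) (graph_dist V E y v) = r}"

text \<open>The arc of radius \<open>r\<close> of the directed edge from \<open>w'\<close> to \<open>w\<close>.\<close>

primrec edge_arc :: "'a set \<Rightarrow> 'a set set \<Rightarrow> nat \<Rightarrow> 'a \<Rightarrow> 'a \<Rightarrow> 'a set set" where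
  "edge_arc V E 0 w' w = {{w', w}}"
| "edge_arc V E (Suc r) w' w = edge_sphere V E (Suc r) w' \<inter> edge_sphere V E r w"

definition edge_tube :: "'a set \<Rightarrow> 'a set set \<Rightarrow> nat \<Rightarrow> 'a set \<Rightarrow> 'a set set" where
  "edge_tube V E r W =
     {{x, y} | x y. {x, y} \<in> E \<and>
        Min ((\<lambda>z. min (graph_dist V E x z) (graph_dist V E y z)) ` W) = r}"


definition average :: "'b set \<Rightarrow> ('b \<Rightarrow> real) \<Rightarrow> real" where
  "average A f = (\<Sum>x\<in>A. f x) / real (card A)"

definition edge_inner :: "'a set set \<Rightarrow> ('a set \<Rightarrow> real) \<Rightarrow> ('a set \<Rightarrow> real) \<Rightarrow> real" where
  "edge_inner E f g = (\<Sum>e\<in>E. f e * g e)"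

definition edge_norm :: "'a set set \<Rightarrow> ('a set \<Rightarrow> real) \<Rightarrow> real" where
  "edge_norm E f = sqrt (edge_inner E f f)"

text \<open>The arc average \<open>M\<^sub>r\<^sub>,\<^sub>a(f)\<close>, where \<open>a\<close> is the directed edge of the covering tree from \<open>w'\<close> to \<open>w\<close>.\<close>

definition arc_average ::
    "'a set \<Rightarrow> 'a set set \<Rightarrow> 'a \<Rightarrow> nat \<Rightarrow> 'a list \<Rightarrow> 'a list \<Rightarrow> ('a set \<Rightarrow> real) \<Rightarrow> real" where
  "arc_average V E o\<^sub>G r w' w f =
     average (edge_arc (cover_verts V E o\<^sub>G) (cover_edges V E o\<^sub>G) r w' w) (lift f)"

text \<open>The directed edge from \<open>w'\<close> to \<open>w\<close> of the covering tree is a lift of the directed edge from \<open>u\<close>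
  to \<open>v\<close> of the graph.\<close>

definition lifts_edge ::
    "'a set \<Rightarrow> 'a set set \<Rightarrow> 'a \<Rightarrow> 'a list \<Rightarrow> 'a list \<Rightarrow> 'a \<Rightarrow> 'a \<Rightarrow> bool" where
  "lifts_edge V E o\<^sub>G w' w u v \<longleftrightarrow> {w', w} \<in> cover_edges V E o\<^sub>G \<and> last w' = u \<and> last w = v"

end

theory Submission
  imports Defs "HOL-Library.Sublist"
begin

text \<open>The rate \<open>\<beta>\<close> may be any number of \<open>[(pq)\<^sup>-\<^sup>1\<^sup>/\<^sup>4, 1)\<close>, so the theorem says that arc and tube averages converge
  exponentially fast to the mean, with a constant and a rate that serve all \<open>f\<close> at once. This is a
  spectral gap statement, and the gap has an elementary source.

  Let \<open>S\<close>, \<open>T\<close> be the two sides of \<open>G\<close>. For \<open>f\<close> on the edges of \<open>G\<close> let \<open>P\<^sub>S f\<close> at an edge \<open>e\<close> be the average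
  of \<open>f\<close> over the other edges that share with \<open>e\<close> its endpoint in \<open>S\<close>, and define \<open>P\<^sub>T\<close> likewise. An arc
  of radius \<open>r + 1\<close> is the disjoint union of the arcs of radius \<open>r\<close> of the edges that continue the given
  directed edge (\<open>edge_arc_Suc\<close>, \<open>edge_arc_disjoint\<close>). The projection is bijective on the edges at each
  vertex, and by semiregularity these smaller arcs all have the same size. Hence
  the arc average of \<open>f\<close> at a directed edge whose target lies in \<open>S\<close> is \<open>P\<^sub>S P\<^sub>T P\<^sub>S \<dots> f\<close>, with \<open>r\<close> factors,
  evaluated at the edge below (\<open>arc_sum\<close>).

  Each factor preserves the sum and does not increase the \<open>\<ell>\<^sup>2\<close> norm. On the edges at one vertex \<open>P\<^sub>S\<close> has
  the eigenvalues \<open>1\<close> and \<open>-1/p\<close>, and \<open>p \<ge> 2\<close>, so the norm loss of \<open>P\<^sub>S\<close> controls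
  the oscillation of \<open>f\<close> around every vertex of \<open>S\<close> (\<open>energy_dissipation\<close>). If \<open>P\<^sub>S P\<^sub>T\<close> loses little norm on
  \<open>f\<close>, then \<open>f\<close> oscillates little around the vertices of either side, hence little
  on the whole connected graph, and a function of mean zero with small oscillation is small. So \<open>P\<^sub>S P\<^sub>T\<close> is a
  strict contraction on functions of mean zero (\<open>two_step_contraction\<close>), which gives part (i).

  A tube of radius \<open>r \<ge> 1\<close> around \<open>X\<close> is the disjoint union of the arcs of radius \<open>r\<close> of the edges that leave \<open>X\<close>
  (\<open>edge_tube_Suc\<close>, \<open>boundary_arcs_disjoint\<close>), so its average is a weighted mean of arc averages and inherits
  their bound. For \<open>r = 0\<close> the bound only compares values of \<open>f\<close> with its norm.\<close>

section \<open>Averaging over the other members of a class\<close>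

definition star_average :: "'e set \<Rightarrow> ('e \<Rightarrow> 'c) \<Rightarrow> ('e \<Rightarrow> real) \<Rightarrow> 'e \<Rightarrow> real" where
  "star_average E c f e = average {e'\<in>E. c e' = c e \<and> e' \<noteq> e} f"

text \<open>In the application \<open>E\<close> is the edge set of the graph and \<open>c\<close> maps an edge to its endpoint on one side,
  so that the classes are the stars of the vertices on that side.\<close>

locale equipartition =
  fixes E :: "'e set" and c :: "'e \<Rightarrow> 'c" and k :: nat
  assumes finite_E: "finite E"
    and card_class: "e \<in> E \<Longrightarrow> card {e'\<in>E. c e' = c e} = Suc k"
    and k_ge_2: "k \<ge> 2"
begin

definition class_sum :: "('e \<Rightarrow> real) \<Rightarrow> 'e \<Rightarrow> real" where
  "class_sum f e = (\<Sum>e'\<in>{e'\<in>E. c e' = c e}. f e')"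

lemma card_others:
  assumes "e \<in> E"
  shows "card {e'\<in>E. c e' = c e \<and> e' \<noteq> e} = k"
proof -
  have "{e'\<in>E. c e' = c e \<and> e' \<noteq> e} = {e'\<in>E. c e' = c e} - {e}" by auto
  then show ?thesis using card_class[OF assms] assms finite_E by simp
qed

lemma star_average_eq:
  assumes "e \<in> E"
  shows "star_average E c f e = (class_sum f e - f e) / k"
proof -
  have "{e'\<in>E. c e' = c e} = insert e {e'\<in>E. c e' = c e \<and> e' \<noteq> e}" using assms by auto
  then have "class_sum f e = f e + (\<Sum>e'\<in>{e'\<in>E. c e' = c e \<and> e' \<noteq> e}. f e')"
    unfolding class_sum_def using finite_E by simp
  then show ?thesis
    by (simp add: star_average_def average_def card_others[OF assms])
qed

lemma sum_class_swap:
  "(\<Sum>e\<in>E. \<Sum>e'\<in>{e'\<in>E. c e' = c e}. g e e') = (\<Sum>e\<in>E. \<Sum>e'\<in>{e'\<in>E. c e' = c e}. g e' e)"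
proof -
  have "(\<Sum>e\<in>E. \<Sum>e'\<in>{e'\<in>E. c e' = c e}. g e e') = (\<Sum>e'\<in>E. \<Sum>e\<in>{e\<in>E. c e' = c e}. g e e')"
    using finite_E by (rule sum.swap_restrict[OF _ finite_E])
  then show ?thesis by (simp add: eq_commute)
qed

lemma sum_class_const:
  "(\<Sum>e\<in>E. \<Sum>e'\<in>{e'\<in>E. c e' = c e}. (g e :: real)) = (real k + 1) * (\<Sum>e\<in>E. g e)"
  by (simp add: card_class sum_distrib_left add.commute cong: sum.cong)

lemma sum_star_average: "(\<Sum>e\<in>E. star_average E c f e) = (\<Sum>e\<in>E. f e)"
proof -
  have "(\<Sum>e\<in>E. class_sum f e) = (real k + 1) * (\<Sum>e\<in>E. f e)"
    unfolding class_sum_def by (subst sum_class_swap) (rule sum_class_const)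
  then have "(\<Sum>e\<in>E. (class_sum f e - f e) / k) = (\<Sum>e\<in>E. f e)"
    using k_ge_2 by (simp add: sum_divide_distrib[symmetric] sum_subtractf field_simps)
  then show ?thesis by (simp add: star_average_eq cong: sum.cong)
qed

text \<open>With \<open>Q\<close> the sum of squares of \<open>f\<close> and \<open>Z\<close> the sum of \<open>f e\<close> times the class sum at \<open>e\<close>, the energy after
  averaging is \<open>((k - 1) Z + Q) / k\<^sup>2\<close>, while the double sum of squared differences is \<open>2 (k + 1) Q - 2 Z\<close>; the two
  combine to the identity. The factor \<open>k - 1\<close> is positive because the nontrivial eigenvalue \<open>-1/k\<close> of the
  averaging operator is not \<open>-1\<close>.\<close>

lemma energy_dissipation:
  "(\<Sum>e\<in>E. (f e)\<^sup>2) - (\<Sum>e\<in>E. (star_average E c f e)\<^sup>2) =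
     (real k - 1) / (2 * (real k)\<^sup>2) * (\<Sum>e\<in>E. \<Sum>e'\<in>{e'\<in>E. c e' = c e}. (f e - f e')\<^sup>2)"
proof -
  define Q where "Q = (\<Sum>e\<in>E. (f e)\<^sup>2)"
  define Z where "Z = (\<Sum>e\<in>E. class_sum f e * f e)"
  have cs: "class_sum f e' = class_sum f e" if "c e' = c e" for e e'
    using that by (simp add: class_sum_def)
  have "(\<Sum>e\<in>E. (class_sum f e)\<^sup>2) = (\<Sum>e\<in>E. \<Sum>e'\<in>{e'\<in>E. c e' = c e}. class_sum f e * f e')"
    by (simp add: power2_eq_square class_sum_def sum_distrib_left)
  also have "\<dots> = (\<Sum>e\<in>E. \<Sum>e'\<in>{e'\<in>E. c e' = c e}. class_sum f e' * f e)"
    by (rule sum_class_swap)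
  also have "\<dots> = (\<Sum>e\<in>E. \<Sum>e'\<in>{e'\<in>E. c e' = c e}. class_sum f e * f e)"
    by (intro sum.cong refl) (auto dest: cs)
  also have "\<dots> = (real k + 1) * Z"
    unfolding Z_def by (rule sum_class_const)
  finally have sq: "(\<Sum>e\<in>E. (class_sum f e)\<^sup>2) = (real k + 1) * Z" .
  have k0: "real k \<noteq> 0" using k_ge_2 by simp
  have "(\<Sum>e\<in>E. (star_average E c f e)\<^sup>2) = (\<Sum>e\<in>E. ((class_sum f e)\<^sup>2 - 2 * (class_sum f e * f e) + (f e)\<^sup>2) / (real k)\<^sup>2)"
    by (intro sum.cong refl) (simp add: star_average_eq power_divide power2_diff algebra_simps)
  also have "\<dots> = ((real k + 1) * Z - 2 * Z + Q) / (real k)\<^sup>2"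
    by (simp add: sum_divide_distrib[symmetric] sum.distrib sum_subtractf sq Z_def Q_def sum_distrib_left)
  finally have P: "(\<Sum>e\<in>E. (star_average E c f e)\<^sup>2) = ((real k - 1) * Z + Q) / (real k)\<^sup>2"
    by (simp add: algebra_simps)
  have "(\<Sum>e\<in>E. \<Sum>e'\<in>{e'\<in>E. c e' = c e}. (f e - f e')\<^sup>2)
      = (\<Sum>e\<in>E. \<Sum>e'\<in>{e'\<in>E. c e' = c e}. (f e)\<^sup>2) + (\<Sum>e\<in>E. \<Sum>e'\<in>{e'\<in>E. c e' = c e}. (f e')\<^sup>2)
        - 2 * (\<Sum>e\<in>E. \<Sum>e'\<in>{e'\<in>E. c e' = c e}. f e' * f e)"
    by (simp add: power2_diff sum.distrib sum_subtractf sum_distrib_left algebra_simps)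
  also have "(\<Sum>e\<in>E. \<Sum>e'\<in>{e'\<in>E. c e' = c e}. (f e')\<^sup>2) = (\<Sum>e\<in>E. \<Sum>e'\<in>{e'\<in>E. c e' = c e}. (f e)\<^sup>2)"
    by (rule sum_class_swap)
  also have "(\<Sum>e\<in>E. \<Sum>e'\<in>{e'\<in>E. c e' = c e}. f e' * f e) = Z"
    by (simp add: Z_def class_sum_def sum_distrib_right)
  finally have D: "(\<Sum>e\<in>E. \<Sum>e'\<in>{e'\<in>E. c e' = c e}. (f e - f e')\<^sup>2) = 2 * (real k + 1) * Q - 2 * Z"
    by (simp only: sum_class_const Q_def)
  show ?thesis
    unfolding P D Q_def[symmetric] using k0 by (simp add: field_simps power2_eq_square)
qed

lemma energy_decreasing: "(\<Sum>e\<in>E. (star_average E c f e)\<^sup>2) \<le> (\<Sum>e\<in>E. (f e)\<^sup>2)"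
proof -
  have "0 \<le> (real k - 1) / (2 * (real k)\<^sup>2) * (\<Sum>e\<in>E. \<Sum>e'\<in>{e'\<in>E. c e' = c e}. (f e - f e')\<^sup>2)"
    using k_ge_2 by (intro mult_nonneg_nonneg sum_nonneg) auto
  then show ?thesis using energy_dissipation[of f] by linarith
qed

text \<open>A single squared difference is at most the double sum in the dissipation identity; the constant is
  generous.\<close>

lemma class_oscillation:
  assumes "e \<in> E" "e' \<in> E" "c e' = c e"
    and D: "(\<Sum>e\<in>E. (f e)\<^sup>2) - (\<Sum>e\<in>E. (star_average E c f e)\<^sup>2) \<le> D"
  shows "\<bar>f e - f e'\<bar> \<le> 2 * real k * sqrt D"
proof -
  have "(f e - f e')\<^sup>2 \<le> (\<Sum>e'\<in>{e'\<in>E. c e' = c e}. (f e - f e')\<^sup>2)"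
    using assms finite_E by (intro member_le_sum) auto
  also have "\<dots> \<le> (\<Sum>e\<in>E. \<Sum>e'\<in>{e'\<in>E. c e' = c e}. (f e - f e')\<^sup>2)"
    using assms finite_E by (intro member_le_sum[of e E "\<lambda>e. \<Sum>e'\<in>{e'\<in>E. c e' = c e}. (f e - f e')\<^sup>2"]) (auto intro: sum_nonneg)
  finally have 1: "(f e - f e')\<^sup>2 \<le> (\<Sum>e\<in>E. \<Sum>e'\<in>{e'\<in>E. c e' = c e}. (f e - f e')\<^sup>2)" (is "_ \<le> ?S") .
  have "?S \<le> (real k - 1) * ?S"
    using k_ge_2 order_trans[OF zero_le_power2 1] by (simp add: mult_le_cancel_right1)
  also have "\<dots> = 2 * (real k)\<^sup>2 * ((\<Sum>e\<in>E. (f e)\<^sup>2) - (\<Sum>e\<in>E. (star_average E c f e)\<^sup>2))"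
    unfolding energy_dissipation using k_ge_2 by simp
  also have "\<dots> \<le> 2 * (real k)\<^sup>2 * D"
    using D by (intro mult_left_mono) auto
  also have "\<dots> \<le> (2 * real k)\<^sup>2 * D"
    using D energy_decreasing[of f] by (simp add: power_mult_distrib)
  finally have "(f e - f e')\<^sup>2 \<le> (2 * real k)\<^sup>2 * D" using 1 by simp
  then have "sqrt ((f e - f e')\<^sup>2) \<le> sqrt ((2 * real k)\<^sup>2 * D)" by (rule real_sqrt_le_mono)
  then show ?thesis by (simp add: real_sqrt_mult)
qed

lemma star_average_oscillation:
  assumes "e \<in> E" and "\<And>e'. e' \<in> E \<Longrightarrow> c e' = c e \<Longrightarrow> \<bar>f e - f e'\<bar> \<le> t"
  shows "\<bar>f e - star_average E c f e\<bar> \<le> t"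
proof -
  let ?O = "{e'\<in>E. c e' = c e \<and> e' \<noteq> e}"
  have k: "real k > 0" using k_ge_2 by simp
  have "real k * (f e - star_average E c f e) = (\<Sum>e'\<in>?O. f e - f e')"
    using k by (simp add: sum_subtractf card_others[OF assms(1)] star_average_def average_def algebra_simps)
  then have "real k * \<bar>f e - star_average E c f e\<bar> = \<bar>\<Sum>e'\<in>?O. f e - f e'\<bar>"
    using k by (metis abs_mult abs_of_pos)
  also have "\<dots> \<le> (\<Sum>e'\<in>?O. \<bar>f e - f e'\<bar>)" by (rule sum_abs)
  also have "\<dots> \<le> (\<Sum>e'\<in>?O. t)" using assms(2) by (intro sum_mono) auto
  also have "\<dots> = real k * t" by (simp add: card_others[OF assms(1)])
  finally show ?thesis using k by simp
qed

end

section \<open>Contraction by two alternating averages\<close>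

definition jointly_connected :: "'e set \<Rightarrow> ('e \<Rightarrow> 'c) \<Rightarrow> ('e \<Rightarrow> 'd) \<Rightarrow> bool" where
  "jointly_connected E c d \<longleftrightarrow>
     (\<forall>a\<in>E. \<forall>b\<in>E. (a, b) \<in> {(a, b). a \<in> E \<and> b \<in> E \<and> (c a = c b \<or> d a = d b)}\<^sup>*)"

text \<open>A value is the mean of its differences to all the values, because these have mean zero.\<close>

lemma mean_zero_bound:
  fixes f :: "'e \<Rightarrow> real"
  assumes "finite E" "(\<Sum>e\<in>E. f e) = 0" and osc: "\<And>a b. a \<in> E \<Longrightarrow> b \<in> E \<Longrightarrow> \<bar>f a - f b\<bar> \<le> t"
    and "a \<in> E"
  shows "\<bar>f a\<bar> \<le> t"
proof -
  have n: "real (card E) > 0" using assms by (simp add: card_gt_0_iff) blast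
  have "real (card E) * f a = (\<Sum>b\<in>E. f a - f b)"
    using assms by (simp add: sum_subtractf)
  then have "real (card E) * \<bar>f a\<bar> = \<bar>\<Sum>b\<in>E. f a - f b\<bar>"
    using n by (metis abs_mult abs_of_pos)
  also have "\<dots> \<le> (\<Sum>b\<in>E. \<bar>f a - f b\<bar>)" by (rule sum_abs)
  also have "\<dots> \<le> (\<Sum>b\<in>E. t)" using osc assms by (intro sum_mono) auto
  also have "\<dots> = real (card E) * t" by simp
  finally show ?thesis using n by simp
qed

text \<open>Let \<open>D\<close> be the energy lost by \<open>f\<close> under both averagings and \<open>g\<close> the function after the first one. Each step loses
  at most \<open>D\<close>, so \<open>f\<close> is almost constant on the classes of \<open>d\<close>, with error of order \<open>sqrt D\<close>, and \<open>g\<close> on those of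
  \<open>c\<close>. Since averaging an almost constant function hardly moves it, \<open>f\<close> is close to \<open>g\<close>, and so \<open>f\<close> is almost
  constant on the classes of \<open>c\<close> too. Chaining these estimates along paths bounds the oscillation, hence for mean
  zero the energy, of \<open>f\<close> by a multiple \<open>K\<close> of \<open>D\<close>, which is a contraction by \<open>1 - 1/K\<close>.\<close>

lemma two_step_contraction:
  assumes c: "equipartition E c k" and d: "equipartition E d l" and conn: "jointly_connected E c d"
  shows "\<exists>\<gamma>. 0 \<le> \<gamma> \<and> \<gamma> < 1 \<and> (\<forall>f. (\<Sum>e\<in>E. f e) = 0 \<longrightarrow>
    (\<Sum>e\<in>E. (star_average E c (star_average E d f) e)\<^sup>2) \<le> \<gamma> * (\<Sum>e\<in>E. (f e)\<^sup>2))"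
proof -
  interpret c: equipartition E c k by fact
  interpret d: equipartition E d l by fact
  define R where "R = {(a, b). a \<in> E \<and> b \<in> E \<and> (c a = c b \<or> d a = d b)}"
  \<comment> \<open>\<open>s\<close> bounds one step between edges of a common class: \<open>2 k\<close> for \<open>g\<close>, and twice \<open>2 l\<close> for passing
    from \<open>f\<close> to \<open>g\<close> at both ends\<close>
  define s where "s = 2 * real k + 4 * real l"
  define N where "N = real (card R)"
  define K where "K = real (card E) * (N * s)\<^sup>2 + 1"
  have K: "K \<ge> 1" by (simp add: K_def)
  have finR: "finite R"
    by (rule finite_subset[of _ "E \<times> E"]) (auto simp: R_def d.finite_E)
  have main: "(\<Sum>e\<in>E. (star_average E c (star_average E d f) e)\<^sup>2) \<le> (1 - 1 / K) * (\<Sum>e\<in>E. (f e)\<^sup>2)"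
    if f0: "(\<Sum>e\<in>E. f e) = 0" for f
  proof -
    define g where "g = star_average E d f"
    define D where "D = (\<Sum>e\<in>E. (f e)\<^sup>2) - (\<Sum>e\<in>E. (star_average E c g e)\<^sup>2)"
    have gD: "(\<Sum>e\<in>E. (g e)\<^sup>2) - (\<Sum>e\<in>E. (star_average E c g e)\<^sup>2) \<le> D"
      using d.energy_decreasing[of f] by (simp add: D_def g_def)
    have fD: "(\<Sum>e\<in>E. (f e)\<^sup>2) - (\<Sum>e\<in>E. (star_average E d f e)\<^sup>2) \<le> D"
      using c.energy_decreasing[of g] by (simp add: D_def g_def)
    have D0: "D \<ge> 0"
      using fD d.energy_decreasing[of f] by simp
    have dstep: "\<bar>f a - f b\<bar> \<le> 2 * real l * sqrt D" if "a \<in> E" "b \<in> E" "d b = d a" for a b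
      using d.class_oscillation[OF that fD] .
    have fg: "\<bar>f a - g a\<bar> \<le> 2 * real l * sqrt D" if "a \<in> E" for a
      unfolding g_def using that by (intro d.star_average_oscillation dstep) auto
    have step: "\<bar>f a - f b\<bar> \<le> s * sqrt D" if "(a, b) \<in> R" for a b
    proof (cases "d a = d b")
      case True
      have "\<bar>f a - f b\<bar> \<le> 2 * real l * sqrt D"
        using that True by (intro dstep) (auto simp: R_def)
      also have "\<dots> \<le> s * sqrt D"
        using D0 by (intro mult_right_mono) (auto simp: s_def)
      finally show ?thesis .
    next
      case False
      then have ab: "a \<in> E" "b \<in> E" "c b = c a" using that by (auto simp: R_def)
      have "\<bar>g a - g b\<bar> \<le> 2 * real k * sqrt D"
        using c.class_oscillation[OF ab gD] .
      moreover note fg[OF ab(1)] fg[OF ab(2)]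
      moreover have "s * sqrt D = 2 * real k * sqrt D + 2 * real l * sqrt D + 2 * real l * sqrt D"
        by (simp add: s_def algebra_simps)
      ultimately show ?thesis by linarith
    qed
    have path: "\<bar>f a - f b\<bar> \<le> real n * (s * sqrt D)" if "(a, b) \<in> R ^^ n" for a b n
      using that
    proof (induction n arbitrary: b)
      case 0
      then show ?case by simp
    next
      case (Suc n)
      then obtain m where "(a, m) \<in> R ^^ n" "(m, b) \<in> R" by auto
      then have "\<bar>f a - f m\<bar> \<le> real n * (s * sqrt D)" "\<bar>f m - f b\<bar> \<le> s * sqrt D"
        using Suc.IH step by blast+
      then show ?case by (simp add: algebra_simps)
    qed
    have osc: "\<bar>f a - f b\<bar> \<le> N * (s * sqrt D)" if "a \<in> E" "b \<in> E" for a b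
    proof -
      have "(a, b) \<in> R\<^sup>*" using conn that by (simp add: jointly_connected_def R_def)
      then obtain n where n: "n \<le> card R" "(a, b) \<in> R ^^ n"
        using rtrancl_finite_eq_relpow[OF finR] by auto
      have "\<bar>f a - f b\<bar> \<le> real n * (s * sqrt D)" using path n by blast
      also have "\<dots> \<le> N * (s * sqrt D)"
        using n D0 by (intro mult_right_mono) (auto simp: N_def s_def)
      finally show ?thesis .
    qed
    have "(f a)\<^sup>2 \<le> (N * s)\<^sup>2 * D" if "a \<in> E" for a
    proof -
      have "\<bar>f a\<bar> \<le> N * (s * sqrt D)"
        using mean_zero_bound[OF d.finite_E f0 osc that] .
      then have "\<bar>f a\<bar>\<^sup>2 \<le> (N * (s * sqrt D))\<^sup>2" by (intro power_mono) auto
      then show ?thesis using D0 by (simp add: power_mult_distrib)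
    qed
    then have "(\<Sum>e\<in>E. (f e)\<^sup>2) \<le> (\<Sum>e\<in>E. (N * s)\<^sup>2 * D)" by (intro sum_mono) auto
    also have "\<dots> \<le> K * D" using D0 by (simp add: K_def algebra_simps)
    finally have "(\<Sum>e\<in>E. (f e)\<^sup>2) / K \<le> D" using K by (simp add: field_simps)
    then show ?thesis unfolding D_def g_def by (simp add: algebra_simps)
  qed
  show ?thesis
    using K main by (intro exI[of _ "1 - 1 / K"]) auto
qed

section \<open>Arcs and tubes in a tree\<close>

text \<open>All facts about trees below follow from the behaviour of the distance along edges: it changes by exactly one, and
  from each vertex exactly one neighbour is closer to a given other vertex.\<close>

locale metric_tree =
  fixes V :: "'v set" and E :: "'v set set"
  assumes edge_verts: "{x, y} \<in> E \<Longrightarrow> x \<in> V \<and> y \<in> V"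
    and dist_sym: "x \<in> V \<Longrightarrow> y \<in> V \<Longrightarrow> graph_dist V E x y = graph_dist V E y x"
    and dist_eq_0: "x \<in> V \<Longrightarrow> y \<in> V \<Longrightarrow> graph_dist V E x y = 0 \<longleftrightarrow> x = y"
    and dist_edge: "{x, y} \<in> E \<Longrightarrow> z \<in> V \<Longrightarrow>
      graph_dist V E y z = Suc (graph_dist V E x z) \<or> graph_dist V E x z = Suc (graph_dist V E y z)"
    and closer_ex: "x \<in> V \<Longrightarrow> z \<in> V \<Longrightarrow> x \<noteq> z \<Longrightarrow>
      \<exists>y. {x, y} \<in> E \<and> graph_dist V E x z = Suc (graph_dist V E y z)"
    and closer_unique: "z \<in> V \<Longrightarrow> {x, y} \<in> E \<Longrightarrow> {x, y'} \<in> E \<Longrightarrow>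
      graph_dist V E x z = Suc (graph_dist V E y z) \<Longrightarrow>
      graph_dist V E x z = Suc (graph_dist V E y' z) \<Longrightarrow> y = y'"
begin

abbreviation \<delta> :: "'v \<Rightarrow> 'v \<Rightarrow> nat" where "\<delta> \<equiv> graph_dist V E"

lemma dist_edge_right:
  assumes "{x, y} \<in> E" "z \<in> V"
  shows "\<delta> z y = Suc (\<delta> z x) \<or> \<delta> z x = Suc (\<delta> z y)"
  using dist_edge[OF assms] edge_verts[OF assms(1)] assms(2) dist_sym by metis

lemma dist_refl: "x \<in> V \<Longrightarrow> \<delta> x x = 0"
  using dist_eq_0 by simp

lemma dist_adjacent:
  assumes "{x, y} \<in> E"
  shows "\<delta> x y = 1"
  using dist_edge[OF assms, of y] edge_verts[OF assms] dist_refl[of y] by auto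

lemma closer_right_ex:
  assumes "x \<in> V" "z \<in> V" "x \<noteq> z"
  obtains y where "{x, y} \<in> E" "\<delta> z x = Suc (\<delta> z y)"
  using closer_ex[OF assms] assms dist_sym edge_verts by metis

lemma closer_right_unique:
  assumes "z \<in> V" "{x, y} \<in> E" "{x, y'} \<in> E" "\<delta> z x = Suc (\<delta> z y)" "\<delta> z x = Suc (\<delta> z y')"
  shows "y = y'"
  using closer_unique[OF assms(1-3)] assms dist_sym edge_verts by metis

lemma dist_triangle:
  assumes "x \<in> V" "y \<in> V" "z \<in> V"
  shows "\<delta> x z \<le> \<delta> x y + \<delta> y z"
  using assms
proof (induction "\<delta> y z" arbitrary: z)
  case 0
  then show ?case using dist_eq_0[of y z] by simp
next
  case (Suc n)
  then have "z \<noteq> y" using dist_refl by auto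
  then obtain u where u: "{z, u} \<in> E" "\<delta> y z = Suc (\<delta> y u)"
    using closer_right_ex[of z y] Suc.prems by blast
  then have "\<delta> x u \<le> \<delta> x y + \<delta> y u"
    using Suc edge_verts by auto
  moreover have "\<delta> x z \<le> Suc (\<delta> x u)"
    using dist_edge_right[OF u(1), of x] Suc.prems by auto
  ultimately show ?case using u by simp
qed

lemma edge_sphere_iff:
  assumes "{x, y} \<in> E"
  shows "{x, y} \<in> edge_sphere V E r v \<longleftrightarrow> min (\<delta> x v) (\<delta> y v) = r"
  using assms unfolding edge_sphere_def
  by (auto simp: doubleton_eq_iff min.commute)

lemma edge_oriented:
  assumes "{x0, y0} \<in> E" "z \<in> V" "min (\<delta> x0 z) (\<delta> y0 z) = n"
  obtains x y where "{x0, y0} = {x, y}" "\<delta> x z = n" "\<delta> y z = Suc n"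
proof (cases "\<delta> x0 z < \<delta> y0 z")
  case True
  then show ?thesis using that[of x0 y0] dist_edge[OF assms(1,2)] assms(3) by auto
next
  case False
  then have "\<delta> y0 z = n" "\<delta> x0 z = Suc n" using dist_edge[OF assms(1,2)] assms(3) by auto
  then show ?thesis using that[of y0 x0] by (simp add: insert_commute)
qed

text \<open>The neighbour \<open>u\<close> of \<open>y\<close> towards \<open>w\<close> is also closer to \<open>w'\<close>, and \<open>x\<close> is the only such neighbour of \<open>y\<close>.\<close>

lemma near_end_dist:
  assumes w: "{w', w} \<in> E" and xy: "{x, y} \<in> E"
    and d: "\<delta> x w' = Suc n" "\<delta> y w' = Suc (Suc n)" "\<delta> y w = Suc n"
  shows "\<delta> x w = n"
proof -
  have V: "w' \<in> V" "w \<in> V" "y \<in> V" using edge_verts[OF w] edge_verts[OF xy] by auto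
  have "y \<noteq> w" using d(3) dist_refl V by auto
  then obtain u where u: "{y, u} \<in> E" "\<delta> y w = Suc (\<delta> u w)"
    using closer_ex V by blast
  have "u \<in> V" using edge_verts u by blast
  then have "\<delta> u w' \<le> Suc n" using dist_edge_right[OF w, of u] u d by auto
  then have "\<delta> y w' = Suc (\<delta> u w')"
    using dist_edge[OF u(1) V(1)] d by auto
  moreover have "{y, x} \<in> E" using xy by (simp add: insert_commute)
  ultimately have "u = x"
    using closer_unique[OF V(1) u(1), of x] d by simp
  then show ?thesis using u d by simp
qed

text \<open>Orienting the edges of an arc away from its base makes them correspond to their far ends \<open>y\<close>, and membership
  becomes a condition on distances that treats radius \<open>0\<close> like the other radii.\<close>

lemma edge_arc_eq:
  assumes w: "{w', w} \<in> E"
  shows "edge_arc V E r w' w =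
    {{x, y} | x y. {x, y} \<in> E \<and> \<delta> x w' = r \<and> \<delta> y w' = Suc r \<and> \<delta> y w = r}"
proof (cases r)
  case 0
  have "w' \<in> V" "w \<in> V" using edge_verts[OF w] by auto
  moreover have "\<delta> w w' = 1" using dist_adjacent[of w w'] w by (simp add: insert_commute)
  ultimately have "{x, y} \<in> E \<and> \<delta> x w' = 0 \<and> \<delta> y w' = Suc 0 \<and> \<delta> y w = 0 \<longleftrightarrow> x = w' \<and> y = w" for x y
    using w dist_eq_0 edge_verts by fastforce
  then show ?thesis using 0 by auto
next
  case (Suc n)
  have V: "w' \<in> V" "w \<in> V" using edge_verts[OF w] by auto
  show ?thesis
  proof (intro subset_antisym subsetI)
    fix e assume "e \<in> edge_arc V E r w' w"
    then have e: "e \<in> edge_sphere V E (Suc n) w'" "e \<in> edge_sphere V E n w" using Suc by auto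
    from e(1) obtain x0 y0 where xy0: "e = {x0, y0}" "{x0, y0} \<in> E" "min (\<delta> x0 w') (\<delta> y0 w') = Suc n"
      unfolding edge_sphere_def by auto
    \<comment> \<open>the two ends lie at different distances from \<open>w'\<close>; call \<open>x\<close> the nearer one\<close>
    obtain x y where xy: "e = {x, y}" "{x, y} \<in> E" "\<delta> x w' = Suc n" "\<delta> y w' = Suc (Suc n)"
      using edge_oriented[OF xy0(2) V(1) xy0(3)] xy0(1,2) by metis
    have mn: "min (\<delta> x w) (\<delta> y w) = n"
      using e(2) edge_sphere_iff[OF xy(2)] xy(1) by blast
    have "y \<in> V" using edge_verts xy by blast
    then have "\<delta> y w \<ge> Suc n" using dist_edge_right[OF w, of y] xy(4) by auto
    then have "\<delta> y w = Suc n"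
      using mn dist_edge[OF xy(2) V(2)] by auto
    then show "e \<in> {{x, y} |x y. {x, y} \<in> E \<and> \<delta> x w' = r \<and> \<delta> y w' = Suc r \<and> \<delta> y w = r}"
      using xy Suc by blast
  next
    fix e assume "e \<in> {{x, y} |x y. {x, y} \<in> E \<and> \<delta> x w' = r \<and> \<delta> y w' = Suc r \<and> \<delta> y w = r}"
    then obtain x y where xy: "e = {x, y}" "{x, y} \<in> E" "\<delta> x w' = Suc n" "\<delta> y w' = Suc (Suc n)"
      "\<delta> y w = Suc n" using Suc by auto
    have "\<delta> x w = n" using near_end_dist[OF w xy(2-5)] .
    then show "e \<in> edge_arc V E r w' w"
      using Suc xy edge_sphere_iff[OF xy(2)] by simp
  qed
qed

text \<open>The continuation \<open>z\<close> whose arc contains an edge is the neighbour of \<open>w\<close> towards the far end of that edge; this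
  also makes the union disjoint.\<close>

lemma edge_arc_Suc:
  assumes w: "{w', w} \<in> E"
  shows "edge_arc V E (Suc r) w' w = (\<Union>z\<in>{z. {w, z} \<in> E \<and> z \<noteq> w'}. edge_arc V E r w z)"
proof (intro subset_antisym subsetI)
  have V: "w' \<in> V" "w \<in> V" using edge_verts[OF w] by auto
  {
    fix e assume "e \<in> edge_arc V E (Suc r) w' w"
    then obtain x y where xy: "e = {x, y}" "{x, y} \<in> E" "\<delta> x w' = Suc r" "\<delta> y w' = Suc (Suc r)"
      "\<delta> y w = Suc r" unfolding edge_arc_eq[OF w] by auto
    have xyV: "x \<in> V" "y \<in> V" using edge_verts xy by blast+
    have "w \<noteq> y" using xy(5) dist_refl V by auto
    then obtain z where z: "{w, z} \<in> E" "\<delta> y w = Suc (\<delta> y z)"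
      using closer_right_ex V xyV by metis
    have "z \<noteq> w'" using z xy by auto
    moreover have "\<delta> x w = r" using near_end_dist[OF w xy(2-5)] .
    ultimately have "e \<in> edge_arc V E r w z" "z \<in> {z. {w, z} \<in> E \<and> z \<noteq> w'}"
      unfolding edge_arc_eq[OF z(1)] using xy z by auto
    then show "e \<in> (\<Union>z\<in>{z. {w, z} \<in> E \<and> z \<noteq> w'}. edge_arc V E r w z)" by blast
  next
    fix e assume "e \<in> (\<Union>z\<in>{z. {w, z} \<in> E \<and> z \<noteq> w'}. edge_arc V E r w z)"
    then obtain z where z: "{w, z} \<in> E" "z \<noteq> w'" "e \<in> edge_arc V E r w z" by blast
    then obtain x y where xy: "e = {x, y}" "{x, y} \<in> E" "\<delta> x w = r" "\<delta> y w = Suc r" "\<delta> y z = r"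
      unfolding edge_arc_eq[OF z(1)] by auto
    have xyV: "x \<in> V" "y \<in> V" using edge_verts xy by blast+
    have w2: "{w, w'} \<in> E" using w by (simp add: insert_commute)
    have "\<delta> y w \<noteq> Suc (\<delta> y w')"
      using closer_right_unique[OF xyV(2) z(1) w2] z(2) xy by metis
    then have "\<delta> y w' = Suc (Suc r)"
      using dist_edge_right[OF w xyV(2)] xy by simp
    moreover have "\<delta> x w' = Suc r"
      using dist_edge_right[OF w xyV(1)] dist_edge[OF xy(2) V(1)] calculation xy(3) by arith
    ultimately show "e \<in> edge_arc V E (Suc r) w' w"
      unfolding edge_arc_eq[OF w] using xy by blast
  }
qed

lemma edge_arc_disjoint:
  assumes z: "{w, z} \<in> E" and z': "{w, z'} \<in> E" and "z \<noteq> z'"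
  shows "edge_arc V E r w z \<inter> edge_arc V E r w z' = {}"
proof (rule ccontr)
  assume "edge_arc V E r w z \<inter> edge_arc V E r w z' \<noteq> {}"
  then obtain x y x' y' where xy: "{x, y} = {x', y'}" "{x, y} \<in> E"
    "\<delta> x w = r" "\<delta> y w = Suc r" "\<delta> y z = r" "\<delta> x' w = r" "\<delta> y' w = Suc r" "\<delta> y' z' = r"
    unfolding edge_arc_eq[OF z] edge_arc_eq[OF z'] by blast
  then have "y' = y" by (auto simp: doubleton_eq_iff)
  moreover have "y \<in> V" using edge_verts xy by blast
  ultimately show False
    using closer_right_unique[OF _ z z', of y] xy assms by simp
qed

definition boundary :: "'v set \<Rightarrow> ('v \<times> 'v) set" where
  "boundary W = {(w', w). w' \<in> W \<and> w \<notin> W \<and> {w', w} \<in> E}"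

text \<open>Seen from a vertex \<open>y\<close> of the branch beyond a boundary edge, \<open>w'\<close> is the gate of \<open>W\<close>: every geodesic from \<open>y\<close> into \<open>W\<close>
  passes through it. The equation propagates along walks in \<open>W\<close>: at a vertex \<open>x \<noteq> w'\<close> the step towards \<open>w'\<close> is also
  the step towards \<open>y\<close>, so any other step moves away from both, and at \<open>w'\<close> the step towards \<open>y\<close> leads to \<open>w\<close>,
  outside \<open>W\<close>.\<close>

lemma gate:
  assumes W: "subgraph W F V E" "connected_graph W F"
    and b: "(w', w) \<in> boundary W" and y: "y \<in> V" "\<delta> y w' = Suc (\<delta> y w)" and z: "z \<in> W"
  shows "\<delta> y z = \<delta> y w' + \<delta> w' z"
proof -
  have b': "w' \<in> W" "w \<notin> W" "{w', w} \<in> E" using b by (auto simp: boundary_def)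
  then have V: "w' \<in> V" using edge_verts by blast
  have walks: "\<delta> y (last xs) = \<delta> y w' + \<delta> w' (last xs)" if "walk W F xs" "hd xs = w'" for xs
    using that
  proof (induction xs rule: rev_induct)
    case Nil
    then show ?case by (simp add: walk_def)
  next
    case (snoc v xs)
    show ?case
    proof (cases "xs = []")
      case True
      then show ?thesis using snoc V dist_refl by simp
    next
      case False
      define x where "x = last xs"
      have wk: "walk W F xs" "hd xs = w'" "{x, v} \<in> F" "v \<in> W"
        using snoc.prems False by (auto simp: walk_def successively_append_iff x_def)
      have xv: "{x, v} \<in> E" using wk W(1) by (auto simp: subgraph_def)
      have IH: "\<delta> y x = \<delta> y w' + \<delta> w' x" using snoc.IH wk by (simp add: x_def)
      have vV: "x \<in> V" "v \<in> V" using edge_verts xv by auto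
      show ?thesis
      proof (cases "x = w'")
        case True
        have "v \<noteq> w" using wk b' by auto
        then have "\<delta> y v = Suc (\<delta> y x)"
          using dist_edge_right[OF xv y(1)] closer_right_unique[OF y(1), of w' v w] xv b' y True by auto
        then show ?thesis using True dist_adjacent[OF xv] IH dist_refl V by simp
      next
        case False
        \<comment> \<open>the step from \<open>x\<close> towards \<open>w'\<close> is also the step from \<open>x\<close> towards \<open>y\<close>\<close>
        obtain u where u: "{x, u} \<in> E" "\<delta> w' x = Suc (\<delta> w' u)"
          using closer_right_ex[OF vV(1) V False] by blast
        have uV: "u \<in> V" using edge_verts u by blast
        have le: "\<delta> y u \<le> \<delta> y w' + \<delta> w' u" using dist_triangle[OF y(1) V uV] .
        have uy: "\<delta> y x = Suc (\<delta> y u)"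
          using dist_edge_right[OF u(1) y(1)] le IH u(2) by arith
        show ?thesis
        proof (cases "u = v")
          case True
          then show ?thesis using uy u(2) IH unfolding True by simp
        next
          case False
          then have "\<delta> w' v = Suc (\<delta> w' x)" "\<delta> y v = Suc (\<delta> y x)"
            using dist_edge_right[OF xv V] closer_right_unique[OF V xv u(1) _ u(2)]
              dist_edge_right[OF xv y(1)] closer_right_unique[OF y(1) xv u(1) _ uy] by metis+
          then show ?thesis using IH by simp
        qed
      qed
    qed
  qed
  obtain xs where "walk W F xs" "hd xs = w'" "last xs = z"
    using W(2) b' z unfolding connected_graph_def by blast
  then show ?thesis using walks by blast
qed

lemma edge_tube_iff:
  assumes "{x, y} \<in> E" "finite W" "W \<noteq> {}"
  shows "{x, y} \<in> edge_tube V E r W \<longleftrightarrow>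
    (\<forall>z\<in>W. r \<le> min (\<delta> x z) (\<delta> y z)) \<and> (\<exists>z\<in>W. min (\<delta> x z) (\<delta> y z) = r)"
proof -
  have "{x, y} \<in> edge_tube V E r W \<longleftrightarrow> Min ((\<lambda>z. min (\<delta> x z) (\<delta> y z)) ` W) = r"
    using assms(1) unfolding edge_tube_def
    by (auto simp: doubleton_eq_iff min.commute)
  also have "\<dots> \<longleftrightarrow> (\<forall>z\<in>W. r \<le> min (\<delta> x z) (\<delta> y z)) \<and> (\<exists>z\<in>W. min (\<delta> x z) (\<delta> y z) = r)"
    using assms by (subst Min_eq_iff) (auto simp del: min.bounded_iff)
  finally show ?thesis .
qed

text \<open>An edge of the tube lies in the arc of the first edge of the geodesic to it from a nearest vertex \<open>w'\<close> of \<open>W\<close>. Conversely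
  the gate property shows that on an arc leaving \<open>W\<close> at \<open>w'\<close> the distance to \<open>W\<close> is attained at \<open>w'\<close>.\<close>

lemma edge_tube_Suc:
  assumes W: "subgraph W F V E" "connected_graph W F" "finite W"
  shows "edge_tube V E (Suc r) W = (\<Union>(w', w)\<in>boundary W. edge_arc V E (Suc r) w' w)"
proof (intro subset_antisym subsetI)
  have ne: "W \<noteq> {}" using W by (simp add: connected_graph_def)
  have WV: "W \<subseteq> V" using W by (simp add: subgraph_def)
  {
    fix e assume e: "e \<in> edge_tube V E (Suc r) W"
    then obtain x0 y0 where xy0: "e = {x0, y0}" "{x0, y0} \<in> E" by (auto simp: edge_tube_def)
    then obtain w' where w': "w' \<in> W" "min (\<delta> x0 w') (\<delta> y0 w') = Suc r"
      using edge_tube_iff[OF xy0(2) W(3) ne] e by auto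
    have w'V: "w' \<in> V" using w' WV by blast
    obtain x y where xy: "e = {x, y}" "{x, y} \<in> E" "\<delta> x w' = Suc r" "\<delta> y w' = Suc (Suc r)"
      using edge_oriented[OF xy0(2) w'V w'(2)] xy0 by metis
    have min: "\<And>z. z \<in> W \<Longrightarrow> Suc r \<le> \<delta> x z"
      using edge_tube_iff[OF xy(2) W(3) ne, of "Suc r"] e xy(1) by simp
    have xyV: "x \<in> V" "y \<in> V" using edge_verts xy by blast+
    have "w' \<noteq> x" using xy dist_refl w'V by auto
    then obtain w where w: "{w', w} \<in> E" "\<delta> x w' = Suc (\<delta> x w)"
      using closer_right_ex w'V xyV by metis
    have "w \<notin> W" using min[of w] w(2) xy(3) by auto
    moreover have "\<delta> y w = Suc r"
      using dist_edge[OF xy(2), of w] dist_edge_right[OF w(1) xyV(2)] edge_verts[OF w(1)] w(2) xy(3,4) by arith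
    ultimately have "(w', w) \<in> boundary W" "e \<in> edge_arc V E (Suc r) w' w"
      unfolding edge_arc_eq[OF w(1)] using xy w w' by (auto simp: boundary_def)
    then show "e \<in> (\<Union>(w', w)\<in>boundary W. edge_arc V E (Suc r) w' w)" by blast
  next
    fix e assume "e \<in> (\<Union>(w', w)\<in>boundary W. edge_arc V E (Suc r) w' w)"
    then obtain w' w where w: "(w', w) \<in> boundary W" "e \<in> edge_arc V E (Suc r) w' w" by blast
    then have wE: "{w', w} \<in> E" "w' \<in> W" by (auto simp: boundary_def)
    obtain x y where xy: "e = {x, y}" "{x, y} \<in> E" "\<delta> x w' = Suc r" "\<delta> y w' = Suc (Suc r)"
      "\<delta> y w = Suc r" using w(2) unfolding edge_arc_eq[OF wE(1)] by blast
    have "y \<in> V" using edge_verts xy by blast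
    then have "\<delta> y z = Suc (Suc r) + \<delta> w' z" if "z \<in> W" for z
      using gate[OF W(1,2) w(1), of y z] xy that by simp
    moreover have "\<delta> x z \<ge> \<delta> y z - 1" if "z \<in> W" for z
    proof -
      have "z \<in> V" using that WV by blast
      then show ?thesis using dist_edge[OF xy(2), of z] by arith
    qed
    ultimately have "Suc r \<le> min (\<delta> x z) (\<delta> y z)" if "z \<in> W" for z
      using that by fastforce
    moreover have "min (\<delta> x w') (\<delta> y w') = Suc r" using xy by simp
    ultimately show "e \<in> edge_tube V E (Suc r) W"
      unfolding xy(1) edge_tube_iff[OF xy(2) W(3) ne] using wE by blast
  }
qed

lemma boundary_arcs_disjoint:
  assumes W: "subgraph W F V E" "connected_graph W F"
    and b: "(w', w) \<in> boundary W" "(v', v) \<in> boundary W" "(w', w) \<noteq> (v', v)"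
  shows "edge_arc V E r w' w \<inter> edge_arc V E r v' v = {}"
proof (rule ccontr)
  assume "edge_arc V E r w' w \<inter> edge_arc V E r v' v \<noteq> {}"
  moreover have E: "{w', w} \<in> E" "{v', v} \<in> E" "w' \<in> W" "v' \<in> W" using b by (auto simp: boundary_def)
  ultimately obtain x y x' y' where xy: "{x, y} = {x', y'}" "{x, y} \<in> E"
    "\<delta> x w' = r" "\<delta> y w' = Suc r" "\<delta> y w = r" "\<delta> x' v' = r" "\<delta> y' v' = Suc r" "\<delta> y' v = r"
    unfolding edge_arc_eq[OF E(1)] edge_arc_eq[OF E(2)] by blast
  have V: "y \<in> V" "w' \<in> V" "v' \<in> V" using edge_verts[OF xy(2)] edge_verts[OF E(1)] edge_verts[OF E(2)] by auto
  have 1: "\<delta> y v' = Suc r + \<delta> w' v'"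
    using gate[OF W b(1) V(1) _ E(4)] xy(4,5) by simp
  have "y' = x \<or> y' = y" using xy(1) by (auto simp: doubleton_eq_iff)
  moreover have "y' \<noteq> x"
  proof
    assume "y' = x"
    then have "x' = y" using xy(1) by (auto simp: doubleton_eq_iff)
    then show False using 1 xy(6) by simp
  qed
  ultimately have "y' = y" by blast
  then have "\<delta> w' v' = 0" using 1 xy(7) by simp
  then have eq: "w' = v'" using dist_eq_0 V by blast
  have "\<delta> y w' = Suc (\<delta> y v)" "{w', v} \<in> E"
    using xy(4,8) E(2) unfolding \<open>y' = y\<close> eq by simp_all
  then have "w = v" using closer_right_unique[OF V(1) E(1), of v] xy(4,5) by metis
  then show False using eq b by simp
qed

text \<open>A vertex of \<open>W\<close> at maximal distance from some vertex of \<open>W\<close> has a neighbour that is still farther away, since at most one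
  of its neighbours is closer.\<close>

lemma boundary_nonempty:
  assumes "finite W" "W \<noteq> {}" "W \<subseteq> V"
    and two: "\<And>x. x \<in> V \<Longrightarrow> \<exists>y z. y \<noteq> z \<and> {x, y} \<in> E \<and> {x, z} \<in> E"
  shows "boundary W \<noteq> {}"
proof -
  obtain a where a: "a \<in> W" using assms by blast
  have "Max ((\<lambda>x. \<delta> x a) ` W) \<in> (\<lambda>x. \<delta> x a) ` W" using assms by (intro Max_in) auto
  then obtain w' where w': "w' \<in> W" "\<And>x. x \<in> W \<Longrightarrow> \<delta> x a \<le> \<delta> w' a"
    using Max_ge[OF finite_imageI[OF assms(1)], of _ "\<lambda>x. \<delta> x a"] by fastforce
  obtain y z where yz: "y \<noteq> z" "{w', y} \<in> E" "{w', z} \<in> E" using two w' assms by blast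
  have aV: "a \<in> V" using a assms by blast
  obtain u where u: "{w', u} \<in> E" "\<delta> u a = Suc (\<delta> w' a)"
    using closer_unique[OF aV yz(2,3)] dist_edge[OF yz(2) aV] dist_edge[OF yz(3) aV] yz by blast
  then have "u \<notin> W" using w'(2)[of u] by auto
  then show ?thesis using u w' by (auto simp: boundary_def)
qed

end

section \<open>The universal covering tree\<close>

text \<open>A function is the distance to \<open>z\<close> if no edge decreases it by more than one and some edge always decreases it.\<close>

lemma graph_dist_eqI:
  fixes d :: "'v \<Rightarrow> nat"
  assumes z: "z \<in> V" "d z = 0" and x: "x \<in> V"
    and lip: "\<And>x y. {x, y} \<in> E \<Longrightarrow> d x \<le> Suc (d y)"
    and zero: "\<And>x. x \<in> V \<Longrightarrow> d x = 0 \<Longrightarrow> x = z"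
    and down: "\<And>x. x \<in> V \<Longrightarrow> d x \<noteq> 0 \<Longrightarrow> \<exists>y\<in>V. {x, y} \<in> E \<and> d x = Suc (d y)"
  shows "graph_dist V E x z = d x"
  unfolding graph_dist_def
proof (rule Least_equality)
  have "\<exists>xs. walk V E xs \<and> hd xs = x \<and> last xs = z \<and> length xs = n + 1" if "d x = n" "x \<in> V" for n x
    using that
  proof (induction n arbitrary: x)
    case 0
    then have "x = z" using zero by blast
    then show ?case using z by (intro exI[of _ "[z]"]) (simp add: walk_def)
  next
    case (Suc n)
    then obtain y where y: "y \<in> V" "{x, y} \<in> E" "d y = n" using down[of x] by auto
    then obtain xs where xs: "walk V E xs" "hd xs = y" "last xs = z" "length xs = n + 1"
      using Suc.IH by blast
    then have "walk V E (x # xs)" using y Suc.prems by (cases xs) (auto simp: walk_def)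
    then show ?case using xs by (intro exI[of _ "x # xs"]) auto
  qed
  then show "\<exists>xs. walk V E xs \<and> hd xs = x \<and> last xs = z \<and> length xs = d x + 1" using x by blast
next
  have "d (hd xs) + 1 \<le> length xs" if "walk V E xs" "last xs = z" for xs
    using that
  proof (induction xs)
    case Nil
    then show ?case by (simp add: walk_def)
  next
    case (Cons a xs)
    show ?case
    proof (cases xs)
      case Nil
      then show ?thesis using Cons.prems z by simp
    next
      case (Cons b ys)
      then have "walk V E xs" "last xs = z" "{a, b} \<in> E" using Cons.prems by (auto simp: walk_def)
      then have "d b + 1 \<le> length xs" using Cons.IH Cons by simp
      then show ?thesis using lip[OF \<open>{a, b} \<in> E\<close>] by simp
    qed
  qed
  then show "d x \<le> n" if "\<exists>xs. walk V E xs \<and> hd xs = x \<and> last xs = z \<and> length xs = n + 1" for n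
    using that by (metis add_le_cancel_right)
qed

definition tree_dist :: "'a list \<Rightarrow> 'a list \<Rightarrow> nat" where
  "tree_dist xs ys = length xs + length ys - 2 * length (longest_common_prefix xs ys)"

lemma longest_common_prefix_commute: "longest_common_prefix xs ys = longest_common_prefix ys xs"
  by (induction xs ys rule: longest_common_prefix.induct) auto

lemma longest_common_prefix_le:
  "length (longest_common_prefix xs ys) \<le> length xs"
  "length (longest_common_prefix xs ys) \<le> length ys"
  by (simp_all add: prefix_length_le longest_common_prefix_prefix1 longest_common_prefix_prefix2)

lemma longest_common_prefix_snoc:
  "longest_common_prefix (xs @ [v]) zs =
    (if prefix (xs @ [v]) zs then longest_common_prefix xs zs @ [v] else longest_common_prefix xs zs)"
proof (induction xs arbitrary: zs)
  case Nil
  then show ?case by (cases zs) auto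
next
  case (Cons a xs)
  then show ?case by (cases zs) auto
qed

lemma tree_dist_commute: "tree_dist xs ys = tree_dist ys xs"
  by (simp add: tree_dist_def longest_common_prefix_commute[of xs] add.commute)

text \<open>One step down from \<open>xs\<close> approaches \<open>zs\<close> exactly if it stays on the way from the root to \<open>zs\<close>. This governs all
  distances in the cover.\<close>

lemma tree_dist_snoc:
  "if prefix (xs @ [v]) zs then tree_dist xs zs = Suc (tree_dist (xs @ [v]) zs)
   else tree_dist (xs @ [v]) zs = Suc (tree_dist xs zs)"
  using longest_common_prefix_le[of xs zs] longest_common_prefix_le[of "xs @ [v]" zs]
  by (auto simp: tree_dist_def longest_common_prefix_snoc)

lemma tree_dist_snoc_less:
  "tree_dist (xs @ [v]) zs < tree_dist xs zs \<longleftrightarrow> prefix (xs @ [v]) zs"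
  using tree_dist_snoc[of xs v zs] by (auto split: if_splits)

lemma tree_dist_eq_0: "tree_dist xs ys = 0 \<longleftrightarrow> xs = ys"
proof
  assume "tree_dist xs ys = 0"
  then have "length (longest_common_prefix xs ys) = length xs"
    "length (longest_common_prefix xs ys) = length ys"
    using longest_common_prefix_le[of xs ys] by (auto simp: tree_dist_def)
  then show "xs = ys"
    by (metis longest_common_prefix_prefix1 longest_common_prefix_prefix2 prefixE append_eq_conv_conj take_all_iff order_refl append_Nil2 length_append add_cancel_right_right length_0_conv)
next
  assume "xs = ys"
  moreover have "longest_common_prefix ys ys = ys" by (induction ys) auto
  ultimately show "tree_dist xs ys = 0" by (simp add: tree_dist_def)
qed

locale universal_cover =
  fixes V :: "'a set" and E :: "'a set set" and root :: 'a
  assumes edge_in: "{x, y} \<in> E \<Longrightarrow> x \<in> V \<and> y \<in> V"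
begin

abbreviation CV :: "'a list set" where "CV \<equiv> cover_verts V E root"
abbreviation CE :: "'a list set set" where "CE \<equiv> cover_edges V E root"

lemma cover_not_Nil: "xs \<in> CV \<Longrightarrow> xs \<noteq> []"
  by (auto simp: cover_verts_def walk_def)

lemma last_cover_in: "xs \<in> CV \<Longrightarrow> last xs \<in> V"
  by (auto simp: cover_verts_def walk_def)

lemma cover_snoc_iff:
  assumes "xs \<noteq> []"
  shows "xs @ [v] \<in> CV \<longleftrightarrow>
    xs \<in> CV \<and> {last xs, v} \<in> E \<and> (butlast xs \<noteq> [] \<longrightarrow> last (butlast xs) \<noteq> v)"
proof -
  have nb: "non_backtracking (xs @ [v]) \<longleftrightarrow>
      non_backtracking xs \<and> (butlast xs \<noteq> [] \<longrightarrow> last (butlast xs) \<noteq> v)"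
  proof (cases "butlast xs = []")
    case True
    then have "length xs = 1" using assms by (metis append_butlast_last_id append_Nil length_Cons list.size(3) One_nat_def)
    then show ?thesis using True by (auto simp: non_backtracking_def)
  next
    case False
    then obtain ys a b where xs: "xs = ys @ [a, b]"
      by (metis append.assoc append_Cons append_Nil append_butlast_last_id butlast.simps(1))
    show ?thesis (is "?L \<longleftrightarrow> ?R")
    proof
      assume L: ?L
      have "xs ! i \<noteq> xs ! (i + 2)" if "i + 2 < length xs" for i
        using L[unfolded non_backtracking_def, rule_format, of i] that by (simp add: nth_append)
      moreover have "a \<noteq> v"
        using L[unfolded non_backtracking_def, rule_format, of "length ys"] xs by (simp add: nth_append)
      ultimately show ?R using xs by (simp add: non_backtracking_def butlast_append)
    next
      assume R: ?R
      then have av: "a \<noteq> v" using xs by (simp add: butlast_append)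
      show ?L unfolding non_backtracking_def
      proof (intro allI impI)
        fix i assume i: "i + 2 < length (xs @ [v])"
        show "(xs @ [v]) ! i \<noteq> (xs @ [v]) ! (i + 2)"
        proof (cases "i + 2 < length xs")
          case True
          then show ?thesis using R by (auto simp: non_backtracking_def nth_append)
        next
          case False
          then have "i = length ys" using i xs by simp
          then show ?thesis using av xs by (simp add: nth_append)
        qed
      qed
    qed
  qed
  show ?thesis
    using assms edge_in[of "last xs" v] nb
    by (auto simp: cover_verts_def walk_def successively_append_iff hd_append)
qed

lemma cover_cases:
  assumes "xs \<in> CV"
  obtains "xs = [root]" | ys v where "xs = ys @ [v]" "ys \<in> CV" "ys \<noteq> []"
proof (cases xs rule: rev_cases)
  case Nil
  then show ?thesis using cover_not_Nil assms by blast
next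
  case (snoc ys v)
  show ?thesis
  proof (cases "ys = []")
    case True
    then show ?thesis using that(1) snoc assms by (simp add: cover_verts_def)
  next
    case False
    then show ?thesis using that(2)[of ys v] snoc assms cover_snoc_iff by blast
  qed
qed

lemma cover_prefix:
  assumes "xs @ ys \<in> CV" "xs \<noteq> []"
  shows "xs \<in> CV"
  using assms
proof (induction ys rule: rev_induct)
  case (snoc v ys)
  then show ?case using cover_snoc_iff[of "xs @ ys" v] by simp
qed simp

lemma cover_edge_iff:
  "{x, y} \<in> CE \<longleftrightarrow> x \<in> CV \<and> y \<in> CV \<and> ((\<exists>v. y = x @ [v]) \<or> (\<exists>v. x = y @ [v]))"
  unfolding cover_edges_def by (auto simp: doubleton_eq_iff)

lemma root_prefix:
  assumes "z \<in> CV"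
  shows "prefix [root] z"
  using assms cover_not_Nil[OF assms] by (cases z) (auto simp: cover_verts_def)

text \<open>The step towards \<open>z\<close> goes down if \<open>x\<close> lies on the way from the root to \<open>z\<close>, and to the parent of \<open>x\<close> otherwise.\<close>

lemma cover_closer_ex:
  assumes "x \<in> CV" "z \<in> CV" "x \<noteq> z"
  shows "\<exists>y\<in>CV. {x, y} \<in> CE \<and> tree_dist x z = Suc (tree_dist y z)"
proof (cases "prefix x z")
  case True
  then obtain v vs where z: "z = x @ v # vs" using assms(3) by (metis append_Nil2 neq_Nil_conv prefixE)
  have y: "x @ [v] \<in> CV" using cover_prefix[of "x @ [v]" vs] assms z by simp
  moreover have "prefix (x @ [v]) z" using z by simp
  ultimately show ?thesis
    using tree_dist_snoc[of x v z] assms by (intro bexI[of _ "x @ [v]"]) (auto simp: cover_edge_iff)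
next
  case False
  from assms(1) show ?thesis
  proof (cases rule: cover_cases)
    case 1
    then show ?thesis using root_prefix[OF assms(2)] False by simp
  next
    case (2 ys v)
    then show ?thesis
      using tree_dist_snoc[of ys v z] assms False by (intro bexI[of _ ys]) (auto simp: cover_edge_iff)
  qed
qed

lemma cover_dist_edge:
  assumes "{x, y} \<in> CE"
  shows "tree_dist y z = Suc (tree_dist x z) \<or> tree_dist x z = Suc (tree_dist y z)"
proof -
  have "tree_dist (xs @ [v]) z = Suc (tree_dist xs z) \<or> tree_dist xs z = Suc (tree_dist (xs @ [v]) z)" for xs v
    using tree_dist_snoc[of xs v z] by argo
  then show ?thesis using assms by (auto simp: cover_edge_iff)
qed

lemma cover_graph_dist:
  assumes "x \<in> CV" "z \<in> CV"
  shows "graph_dist CV CE x z = tree_dist x z"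
proof (rule graph_dist_eqI[where d = "\<lambda>u. tree_dist u z"])
  show "tree_dist x z \<le> Suc (tree_dist y z)" if "{x, y} \<in> CE" for x y
    using cover_dist_edge[OF that, of z] by arith
  show "\<exists>y\<in>CV. {x, y} \<in> CE \<and> tree_dist x z = Suc (tree_dist y z)"
    if "x \<in> CV" "tree_dist x z \<noteq> 0" for x
    using cover_closer_ex[OF that(1) assms(2)] that(2) by (simp add: tree_dist_eq_0)
qed (use assms in \<open>auto simp: tree_dist_eq_0\<close>)

sublocale tree: metric_tree CV CE
proof
  show "x \<in> CV \<and> y \<in> CV" if "{x, y} \<in> CE" for x y
    using that by (simp add: cover_edge_iff)
  show "graph_dist CV CE x y = graph_dist CV CE y x" if "x \<in> CV" "y \<in> CV" for x y
    using that by (simp add: cover_graph_dist tree_dist_commute)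
  show "graph_dist CV CE x y = 0 \<longleftrightarrow> x = y" if "x \<in> CV" "y \<in> CV" for x y
    using that by (simp add: cover_graph_dist tree_dist_eq_0)
  show "graph_dist CV CE y z = Suc (graph_dist CV CE x z) \<or> graph_dist CV CE x z = Suc (graph_dist CV CE y z)"
    if "{x, y} \<in> CE" "z \<in> CV" for x y z
    using cover_dist_edge[OF that(1), of z] that by (simp add: cover_graph_dist cover_edge_iff)
  show "\<exists>y. {x, y} \<in> CE \<and> graph_dist CV CE x z = Suc (graph_dist CV CE y z)"
    if "x \<in> CV" "z \<in> CV" "x \<noteq> z" for x z
    using cover_closer_ex[OF that] that by (metis cover_graph_dist)
  show "y = y'"
    if z: "z \<in> CV" and E: "{x, y} \<in> CE" "{x, y'} \<in> CE"
      and d: "graph_dist CV CE x z = Suc (graph_dist CV CE y z)"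
        "graph_dist CV CE x z = Suc (graph_dist CV CE y' z)" for x y y' z
  proof -
    have V: "x \<in> CV" "y \<in> CV" "y' \<in> CV" using E by (auto simp: cover_edge_iff)
    then have lt: "tree_dist y z < tree_dist x z" "tree_dist y' z < tree_dist x z"
      using d z by (simp_all add: cover_graph_dist)
    have child: "prefix u z" if "u = x @ [v]" "tree_dist u z < tree_dist x z" for u v
      using that(2) unfolding that(1) tree_dist_snoc_less .
    have parent: "\<not> prefix x z" if "x = u @ [v]" "tree_dist u z < tree_dist x z" for u v
      using that(2) tree_dist_snoc_less[of u v z] unfolding that(1) by linarith
    consider v v' where "y = x @ [v]" "y' = x @ [v']" | v v' where "y = x @ [v]" "x = y' @ [v']"
      | v v' where "x = y @ [v]" "y' = x @ [v']" | v v' where "x = y @ [v]" "x = y' @ [v']"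
      using E by (auto simp: cover_edge_iff)
    then show "y = y'"
    proof cases
      case 1
      then show ?thesis using child[OF 1(1) lt(1)] child[OF 1(2) lt(2)]
        by (metis length_append_singleton prefix_length_prefix prefix_order.antisym order_refl)
    next
      case 2
      then show ?thesis using child[OF 2(1) lt(1)] parent[OF 2(2) lt(2)] append_prefixD by blast
    next
      case 3
      then show ?thesis using child[OF 3(2) lt(2)] parent[OF 3(1) lt(1)] append_prefixD by blast
    next
      case 4
      then show ?thesis by simp
    qed
  qed
qed

lemma cover_edge_project:
  assumes "{x, y} \<in> CE"
  shows "{last x, last y} \<in> E"
proof -
  have "{last u, last (u @ [v])} \<in> E" if "u \<in> CV" "u @ [v] \<in> CV" for u v
    using that cover_snoc_iff[of u v] cover_not_Nil by auto
  then show ?thesis using assms by (auto simp: cover_edge_iff insert_commute)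
qed

text \<open>The only neighbour of \<open>w\<close> besides its extensions is its parent, and a child over the same vertex as the
  parent would backtrack. Together with the next lemma this says that the projection is a covering.\<close>

lemma last_inj_on_neighbours:
  assumes "{w, y} \<in> CE" "{w, z} \<in> CE" "last y = last z"
  shows "y = z"
proof -
  have no: False if "w @ [v] \<in> CV" "w = u @ [a]" "u \<in> CV" "last u = v" for u v a
    using that cover_snoc_iff[of w v] cover_not_Nil by simp
  have "y \<in> CV" "z \<in> CV" using assms by (auto simp: cover_edge_iff)
  consider v v' where "y = w @ [v]" "z = w @ [v']" | v v' where "y = w @ [v]" "w = z @ [v']"
    | v v' where "w = y @ [v]" "z = w @ [v']" | v v' where "w = y @ [v]" "w = z @ [v']"
    using assms by (auto simp: cover_edge_iff)
  then show ?thesis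
  proof cases
    case 1
    then show ?thesis using assms by simp
  next
    case 2
    have "last z = v" "w @ [v] \<in> CV" using assms(3) 2(1) \<open>y \<in> CV\<close> by simp_all
    then show ?thesis using no[OF _ 2(2) \<open>z \<in> CV\<close>] by blast
  next
    case 3
    have "last y = v'" "w @ [v'] \<in> CV" using assms(3) 3(2) \<open>z \<in> CV\<close> by simp_all
    then show ?thesis using no[OF _ 3(1) \<open>y \<in> CV\<close>] by blast
  next
    case 4
    then show ?thesis by simp
  qed
qed

lemma neighbour_lift:
  assumes "w \<in> CV" "{last w, v} \<in> E"
  obtains z where "{w, z} \<in> CE" "last z = v"
proof (cases "w @ [v] \<in> CV")
  case True
  then show ?thesis using that[of "w @ [v]"] assms by (auto simp: cover_edge_iff)
next
  case False
  have "w \<noteq> []" using assms cover_not_Nil by blast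
  then have b: "butlast w \<noteq> []" "last (butlast w) = v"
    using False assms cover_snoc_iff[of w v] by auto
  have w: "w = butlast w @ [last w]" using \<open>w \<noteq> []\<close> by simp
  then have "butlast w \<in> CV" using assms(1) b(1) cover_snoc_iff[of "butlast w" "last w"] by simp
  then have "{w, butlast w} \<in> CE" using w assms(1) unfolding cover_edge_iff by blast
  then show ?thesis using that b by blast
qed

end

section \<open>Averages and the Euclidean norm\<close>

lemma average_minus_const:
  assumes "finite A" "A \<noteq> {}"
  shows "average A (\<lambda>x. f x - m) = average A f - m"
  using assms by (simp add: average_def sum_subtractf diff_divide_distrib)

lemma edge_norm_eq: "edge_norm E f = sqrt (\<Sum>e\<in>E. (f e)\<^sup>2)"
  by (simp add: edge_norm_def edge_inner_def power2_eq_square)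

lemma edge_norm_nonneg: "edge_norm E f \<ge> 0"
  by (simp add: edge_norm_eq sum_nonneg)

lemma abs_le_edge_norm:
  assumes "finite E" "e \<in> E"
  shows "\<bar>f e\<bar> \<le> edge_norm E f"
proof -
  have "(f e)\<^sup>2 \<le> (\<Sum>e\<in>E. (f e)\<^sup>2)"
    using assms by (intro member_le_sum) auto
  then have "sqrt ((f e)\<^sup>2) \<le> edge_norm E f" unfolding edge_norm_eq by (rule real_sqrt_le_mono)
  then show ?thesis by simp
qed

lemma sum_centred:
  assumes "finite E"
  shows "(\<Sum>e\<in>E. f e - average E f) = 0"
  using assms by (cases "E = {}") (simp_all add: average_def sum_subtractf)

text \<open>Subtracting the mean is an orthogonal projection.\<close>

lemma edge_norm_centred:
  assumes "finite E"
  shows "edge_norm E (\<lambda>e. f e - average E f) \<le> edge_norm E f"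
proof -
  let ?m = "average E f"
  have "(\<Sum>e\<in>E. (f e)\<^sup>2) = (\<Sum>e\<in>E. (f e - ?m)\<^sup>2 + 2 * ?m * (f e - ?m) + ?m\<^sup>2)"
    by (intro sum.cong refl) (simp add: power2_eq_square algebra_simps)
  also have "\<dots> = (\<Sum>e\<in>E. (f e - ?m)\<^sup>2) + 2 * ?m * (\<Sum>e\<in>E. f e - ?m) + real (card E) * ?m\<^sup>2"
    by (simp only: sum.distrib sum_distrib_left sum_constant)
  finally have "(\<Sum>e\<in>E. (f e - ?m)\<^sup>2) \<le> (\<Sum>e\<in>E. (f e)\<^sup>2)"
    by (simp add: sum_centred[OF assms])
  then show ?thesis unfolding edge_norm_eq by (rule real_sqrt_le_mono)
qed

lemma abs_sum_le_card:
  fixes f :: "'e \<Rightarrow> real" and K :: real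
  assumes "\<And>x. x \<in> A \<Longrightarrow> \<bar>f x\<bar> \<le> K"
  shows "\<bar>\<Sum>x\<in>A. f x\<bar> \<le> K * real (card A)"
proof -
  have "\<bar>\<Sum>x\<in>A. f x\<bar> \<le> (\<Sum>x\<in>A. \<bar>f x\<bar>)" by (rule sum_abs)
  also have "\<dots> \<le> (\<Sum>x\<in>A. K)" using assms by (intro sum_mono)
  finally show ?thesis by (simp add: mult.commute)
qed

text \<open>The hypothesis on \<open>K\<close> covers the empty and the infinite sets, on which the average is \<open>0\<close>.\<close>

lemma abs_average_le:
  fixes K :: real
  assumes "\<bar>\<Sum>x\<in>A. f x\<bar> \<le> K * real (card A)" "K \<ge> 0"
  shows "\<bar>average A f\<bar> \<le> K"
  using assms by (cases "card A = 0") (auto simp: average_def field_simps)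


section \<open>Biregular graphs and alternating averages\<close>

text \<open>A semiregular graph whose two sides are matched with the two degrees. The description is symmetric
  under exchanging the sides together with the degrees, so statements about \<open>S\<close> transfer to \<open>T\<close>.\<close>

locale biregular_graph =
  fixes V :: "'a set" and E :: "'a set set" and S T :: "'a set" and p q :: nat
  assumes finite_V: "finite V"
    and parts: "S \<union> T = V" "S \<inter> T = {}"
    and edge_parts: "e \<in> E \<Longrightarrow>
      \<exists>x\<in>S. \<exists>y\<in>T. e = {x, y} \<and> vertex_degree E x = p + 1 \<and> vertex_degree E y = q + 1"
    and connected: "connected_graph V E"
    and p_ge_2: "p \<ge> 2" and q_ge_2: "q \<ge> 2"

lemma biregular_graph_swap:
  assumes "biregular_graph V E S T p q"
  shows "biregular_graph V E T S q p"
proof -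
  interpret biregular_graph V E S T p q by fact
  show ?thesis
  proof
    show "\<exists>x\<in>T. \<exists>y\<in>S. e = {x, y} \<and> vertex_degree E x = q + 1 \<and> vertex_degree E y = p + 1"
      if e: "e \<in> E" for e
    proof -
      from edge_parts[OF e] obtain x y where "x \<in> S" "y \<in> T" "e = {x, y}"
        "vertex_degree E x = p + 1" "vertex_degree E y = q + 1" by blast
      then show ?thesis by (intro bexI[of _ y] bexI[of _ x]) (auto simp: insert_commute)
    qed
  qed (use finite_V parts connected p_ge_2 q_ge_2 in auto)
qed

text \<open>If the two degrees differ, the sides are determined by them; if they agree, any bipartition serves.\<close>

lemma semiregular_imp_biregular:
  assumes "semiregular_graph p q V E" "p \<ge> 2" "q \<ge> 2"
  shows "\<exists>S T. biregular_graph V E S T p q"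
proof (cases "p = q")
  case True
  have fin: "finite V" "connected_graph V E" using assms(1) by (simp_all add: semiregular_graph_def)
  from assms(1) obtain S T where ST: "S \<union> T = V" "S \<inter> T = {}" "\<forall>e\<in>E. \<exists>x\<in>S. \<exists>y\<in>T. e = {x, y}"
    unfolding semiregular_graph_def bipartite_graph_def by blast
  have "biregular_graph V E S T p q"
  proof
    show "\<exists>x\<in>S. \<exists>y\<in>T. e = {x, y} \<and> vertex_degree E x = p + 1 \<and> vertex_degree E y = q + 1"
      if e: "e \<in> E" for e
    proof -
      obtain x y where xy: "x \<in> S" "y \<in> T" "e = {x, y}" using ST(3) e by blast
      obtain x' y' where "e = {x', y'}" "vertex_degree E x' = p + 1" "vertex_degree E y' = p + 1"
        using assms(1) e True unfolding semiregular_graph_def by blast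
      moreover from this(1) have "x = x' \<and> y = y' \<or> x = y' \<and> y = x'"
        unfolding xy(3) doubleton_eq_iff by blast
      ultimately have "vertex_degree E x = p + 1 \<and> vertex_degree E y = p + 1" by blast
      then show ?thesis using xy True by blast
    qed
  qed (use ST(1,2) assms(2,3) fin True in simp_all)
  then show ?thesis by blast
next
  case False
  have fin: "finite V" "connected_graph V E" using assms(1) by (simp_all add: semiregular_graph_def)
  have deg: "\<forall>e\<in>E. \<exists>x y. e = {x, y} \<and> vertex_degree E x = p + 1 \<and> vertex_degree E y = q + 1"
    using assms(1) unfolding semiregular_graph_def by (elim conjE)
  have simple: "simple_graph V E" using assms(1) by (simp add: semiregular_graph_def)
  define S where "S = {v\<in>V. vertex_degree E v = p + 1}"
  have "biregular_graph V E S (V - S) p q"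
  proof
    show "\<exists>x\<in>S. \<exists>y\<in>V - S. e = {x, y} \<and> vertex_degree E x = p + 1 \<and> vertex_degree E y = q + 1"
      if e: "e \<in> E" for e
    proof -
      obtain x y where xy: "e = {x, y}" "vertex_degree E x = p + 1" "vertex_degree E y = q + 1"
        using bspec[OF deg e] by (elim exE conjE)
      moreover have "e \<subseteq> V"
        using bspec[OF simple[unfolded simple_graph_def] e] by blast
      ultimately have "x \<in> S" "y \<in> V - S" using False by (simp_all add: S_def)
      then show ?thesis using xy by blast
    qed
  qed (use assms(2,3) fin in \<open>auto simp: S_def\<close>)
  then show ?thesis by blast
qed

text \<open>The operator \<open>P\<^sub>S P\<^sub>T P\<^sub>S \<dots>\<close> with \<open>r\<close> factors. The outermost factor belongs to the first step of an arc, which is the one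
  at the target of its directed edge; hence the recursion exchanges the sides inside.\<close>

fun alternating_average ::
  "'a set set \<Rightarrow> 'a set \<Rightarrow> 'a set \<Rightarrow> nat \<Rightarrow> ('a set \<Rightarrow> real) \<Rightarrow> 'a set \<Rightarrow> real" where
  "alternating_average E S T 0 f = f"
| "alternating_average E S T (Suc r) f =
    star_average E (\<lambda>e. e \<inter> S) (alternating_average E T S r f)"

text \<open>The number of edges of an arc of radius \<open>r\<close>: the branching numbers \<open>p\<close> and \<open>q\<close> alternate.\<close>

fun arc_size :: "nat \<Rightarrow> nat \<Rightarrow> nat \<Rightarrow> nat" where
  "arc_size p q 0 = 1"
| "arc_size p q (Suc r) = p * arc_size q p r"

lemma arc_size_pos: "p > 0 \<Longrightarrow> q > 0 \<Longrightarrow> arc_size p q r > 0"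
  by (induction p q r rule: arc_size.induct) auto

context biregular_graph
begin

lemma side_vertex:
  assumes "e \<in> E"
  obtains x where "x \<in> S" "x \<in> e" "e \<inter> S = {x}" "vertex_degree E x = p + 1"
proof -
  obtain x y where xy: "x \<in> S" "y \<in> T" "e = {x, y}" "vertex_degree E x = p + 1"
    using edge_parts[OF assms] by blast
  moreover have "y \<notin> S" using xy(2) parts(2) by blast
  then have "e \<inter> S = {x}" using xy(1) unfolding xy(3) by simp
  moreover have "x \<in> e" unfolding xy(3) by simp
  ultimately show ?thesis using that by blast
qed

lemma edge_in_V:
  assumes "{x, y} \<in> E"
  shows "x \<in> V \<and> y \<in> V"
proof -
  obtain x' y' where xy: "x' \<in> S" "y' \<in> T" "{x, y} = {x', y'}" using edge_parts[OF assms] by blast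
  then have "{x, y} \<subseteq> V" unfolding xy(3) using parts(1) by blast
  then show ?thesis by simp
qed

lemma edge_other_side:
  assumes "{x, y} \<in> E" "x \<in> S"
  shows "y \<in> T"
proof -
  obtain x' y' where xy: "x' \<in> S" "y' \<in> T" "{x, y} = {x', y'}" using edge_parts[OF assms(1)] by blast
  then have "y = y'" using parts(2) assms(2) by (auto simp: doubleton_eq_iff)
  then show ?thesis using xy by simp
qed

lemma finite_E: "finite E"
proof (rule finite_subset)
  show "E \<subseteq> Pow V" using edge_parts parts(1) by blast
qed (simp add: finite_V)

lemma edge_Int_side:
  assumes "e \<in> E" "x \<in> S"
  shows "e \<inter> S = {x} \<longleftrightarrow> x \<in> e"
  proof -
  obtain y where y: "e \<inter> S = {y}" using side_vertex[OF assms(1)] by metis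
  have "x \<in> e \<longleftrightarrow> x \<in> e \<inter> S" using assms(2) by simp
  then show ?thesis unfolding y by auto
qed

text \<open>The set \<open>e \<inter> S\<close> contains just the endpoint of \<open>e\<close> in \<open>S\<close> and so serves as its name.\<close>

lemma equipartition_side: "equipartition E (\<lambda>e. e \<inter> S) p"
proof
  show "card {e'\<in>E. e' \<inter> S = e \<inter> S} = Suc p" if e: "e \<in> E" for e
  proof -
    obtain x where x: "x \<in> S" "e \<inter> S = {x}" "vertex_degree E x = p + 1"
      using side_vertex[OF e] by metis
    have "{e'\<in>E. e' \<inter> S = e \<inter> S} = {e'\<in>E. x \<in> e'}"
      using edge_Int_side x by auto
    then show ?thesis using x by (simp add: vertex_degree_def)
  qed
qed (use finite_E p_ge_2 in auto)

text \<open>Successive edges of a walk share a vertex, so any two edges are linked along a walk between their endpoints.\<close>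

lemma jointly_connected_sides: "jointly_connected E (\<lambda>e. e \<inter> S) (\<lambda>e. e \<inter> T)"
proof -
  interpret sw: biregular_graph V E T S q p
    by (rule biregular_graph_swap) (rule biregular_graph_axioms)
  define R where "R = {(a, b). a \<in> E \<and> b \<in> E \<and> (a \<inter> S = b \<inter> S \<or> a \<inter> T = b \<inter> T)}"
  have share: "(a, b) \<in> R" if "a \<in> E" "b \<in> E" "x \<in> a" "x \<in> b" for a b x
  proof -
    have "x \<in> S \<or> x \<in> T" using edge_parts[OF that(1)] that(3) by blast
    then show ?thesis
    proof
      assume "x \<in> S"
      then have "a \<inter> S = {x}" "b \<inter> S = {x}" using edge_Int_side that by blast+
      then show ?thesis using that by (simp add: R_def)
    next
      assume "x \<in> T"
      then have "a \<inter> T = {x}" "b \<inter> T = {x}" using sw.edge_Int_side that by blast+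
      then show ?thesis using that by (simp add: R_def)
    qed
  qed
  have walks: "(a, b) \<in> R\<^sup>*"
    if "walk V E xs" "a \<in> E" "b \<in> E" "hd xs \<in> a" "last xs \<in> b" for xs a b
    using that
  proof (induction xs arbitrary: a)
    case Nil
    then show ?case by (simp add: walk_def)
  next
    case (Cons x xs)
    show ?case
    proof (cases xs)
      case Nil
      then show ?thesis using Cons.prems share by auto
    next
      case (Cons y ys)
      then have xy: "walk V E xs" "{x, y} \<in> E" "hd xs = y"
        using Cons.prems by (auto simp: walk_def)
      then have "({x, y}, b) \<in> R\<^sup>*"
        using Cons.IH[of "{x, y}"] Cons.prems Cons by simp
      moreover have "(a, {x, y}) \<in> R"
        using share[of a "{x, y}" x] Cons.prems xy by simp
      ultimately show ?thesis by (meson converse_rtrancl_into_rtrancl)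
    qed
  qed
  show ?thesis unfolding jointly_connected_def R_def[symmetric]
  proof (intro ballI)
    fix a b assume ab: "a \<in> E" "b \<in> E"
    obtain x where x: "x \<in> a" "x \<in> V" using side_vertex[OF ab(1)] parts(1) by (metis UnCI)
    obtain y where y: "y \<in> b" "y \<in> V" using side_vertex[OF ab(2)] parts(1) by (metis UnCI)
    obtain xs where "walk V E xs" "hd xs = x" "last xs = y"
      using connected x(2) y(2) unfolding connected_graph_def by blast
    then show "(a, b) \<in> R\<^sup>*" using walks ab x(1) y(1) by blast
  qed
qed

lemma sum_alternating_average:
  "(\<Sum>e\<in>E. alternating_average E S T r f e) = (\<Sum>e\<in>E. f e)"
  using biregular_graph_axioms
proof (induction E S T r f arbitrary: p q rule: alternating_average.induct)
  case (1 E S T f)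
  then show ?case by simp
next
  case (2 E S T r f)
  interpret e: equipartition E "\<lambda>e. e \<inter> S" p
    using 2(2) by (rule biregular_graph.equipartition_side)
  show ?case
    using e.sum_star_average[of "alternating_average E T S r f"] 2(1)[OF biregular_graph_swap[OF 2(2)]]
    by simp
qed

lemma alternating_average_contraction:
  "\<exists>\<gamma>. 0 \<le> \<gamma> \<and> \<gamma> < 1 \<and> (\<forall>f r. (\<Sum>e\<in>E. f e) = 0 \<longrightarrow>
    (\<Sum>e\<in>E. (alternating_average E S T r f e)\<^sup>2) \<le> \<gamma> ^ (r div 2) * (\<Sum>e\<in>E. (f e)\<^sup>2))"
proof -
  interpret sw: biregular_graph V E T S q p
    by (rule biregular_graph_swap) (rule biregular_graph_axioms)
  interpret e: equipartition E "\<lambda>e. e \<inter> S" p by (rule equipartition_side)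
  obtain \<gamma> where g: "0 \<le> \<gamma>" "\<gamma> < 1" and contr: "\<And>f. (\<Sum>e\<in>E. f e) = 0 \<Longrightarrow>
    (\<Sum>e\<in>E. (star_average E (\<lambda>e. e \<inter> S) (star_average E (\<lambda>e. e \<inter> T) f) e)\<^sup>2) \<le> \<gamma> * (\<Sum>e\<in>E. (f e)\<^sup>2)"
    using two_step_contraction[OF equipartition_side sw.equipartition_side jointly_connected_sides] by blast
  have "(\<Sum>e\<in>E. (alternating_average E S T r f e)\<^sup>2) \<le> \<gamma> ^ (r div 2) * (\<Sum>e\<in>E. (f e)\<^sup>2)"
    if f: "(\<Sum>e\<in>E. f e) = 0" for f r
  proof (induction r rule: induct_nat_012)
    case 0
    then show ?case by simp
  next
    case 1
    have "(\<Sum>e\<in>E. (star_average E (\<lambda>e. e \<inter> S) f e)\<^sup>2) \<le> (\<Sum>e\<in>E. (f e)\<^sup>2)"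
      by (rule e.energy_decreasing)
    then show ?case by simp
  next
    case (ge2 n)
    have "(\<Sum>e\<in>E. (alternating_average E S T (Suc (Suc n)) f e)\<^sup>2)
        \<le> \<gamma> * (\<Sum>e\<in>E. (alternating_average E S T n f e)\<^sup>2)"
      using contr[of "alternating_average E S T n f"] f by (simp add: sum_alternating_average)
    also have "\<dots> \<le> \<gamma> * (\<gamma> ^ (n div 2) * (\<Sum>e\<in>E. (f e)\<^sup>2))"
      using ge2 g by (intro mult_left_mono) auto
    finally show ?case by (simp add: mult.assoc)
  qed
  then show ?thesis using g by blast
qed

lemma universal_cover: "universal_cover V E"
  using edge_in_V by unfold_locales auto

lemma edge_at_vertex:
  assumes "E \<noteq> {}" "v \<in> V"
  obtains e where "e \<in> E" "v \<in> e"
proof -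
  obtain e where e: "e \<in> E" using assms by blast
  obtain x where x: "x \<in> e" "x \<in> V" using side_vertex[OF e] parts(1) by (metis UnCI)
  show ?thesis
  proof (cases "x = v")
    case True
    then show ?thesis using that e x by blast
  next
    case False
    obtain xs where xs: "walk V E xs" "hd xs = v" "last xs = x"
      using connected assms(2) x(2) unfolding connected_graph_def by blast
    then obtain y ys where "xs = v # y # ys"
      using False by (cases xs rule: remdups_adj.cases) (auto simp: walk_def)
    then have "{v, y} \<in> E" using xs by (simp add: walk_def)
    then show ?thesis using that by blast
  qed
qed

lemma two_neighbours_side:
  assumes "E \<noteq> {}" "v \<in> S"
  shows "\<exists>a b. a \<noteq> b \<and> {v, a} \<in> E \<and> {v, b} \<in> E"
proof -
  interpret e: equipartition E "\<lambda>e. e \<inter> S" p by (rule equipartition_side)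
  obtain e where e: "e \<in> E" "v \<in> e" using edge_at_vertex[OF assms(1)] assms(2) parts(1) by blast
  have "{e'\<in>E. e' \<inter> S = e \<inter> S \<and> e' \<noteq> e} \<noteq> {}"
    using e.card_others[OF e(1)] p_ge_2 by (metis card.empty not_numeral_le_zero)
  then obtain e' where e': "e' \<in> E" "e' \<inter> S = e \<inter> S" "e' \<noteq> e" by blast
  then have "v \<in> e'" using e(2) assms(2) by blast
  obtain a where a: "e = {v, a}" using edge_parts[OF e(1)] e(2) by fast
  obtain b where b: "e' = {v, b}" using edge_parts[OF e'(1)] \<open>v \<in> e'\<close> by fast
  show ?thesis using e e' a b by blast
qed

lemma two_neighbours:
  assumes "E \<noteq> {}" "v \<in> V"
  shows "\<exists>a b. a \<noteq> b \<and> {v, a} \<in> E \<and> {v, b} \<in> E"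
proof -
  interpret sw: biregular_graph V E T S q p
    by (rule biregular_graph_swap) (rule biregular_graph_axioms)
  show ?thesis using assms two_neighbours_side sw.two_neighbours_side parts(1) by blast
qed

lemma alternating_average_one: "e \<in> E \<Longrightarrow> alternating_average E S T r (\<lambda>_. 1) e = 1"
  using biregular_graph_axioms
proof (induction r arbitrary: S T p q e)
  case 0
  then show ?case by simp
next
  case (Suc r)
  interpret e: equipartition E "\<lambda>e. e \<inter> S" p
    using Suc.prems(2) by (rule biregular_graph.equipartition_side)
  define A where "A = {e'\<in>E. e' \<inter> S = e \<inter> S \<and> e' \<noteq> e}"
  have A: "card A = p" using e.card_others[OF Suc.prems(1)] by (simp add: A_def)
  have "(\<Sum>e'\<in>A. alternating_average E T S r (\<lambda>_. 1) e') = (\<Sum>e'\<in>A. 1)"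
    using Suc.IH[OF _ biregular_graph_swap[OF Suc.prems(2)]] by (intro sum.cong) (auto simp: A_def)
  then show ?case using A e.k_ge_2 by (simp add: star_average_def average_def A_def[symmetric])
qed

text \<open>The energy contracts once in two steps, so the norm contracts by \<open>\<gamma>\<^sup>1\<^sup>/\<^sup>4 \<le> \<beta>\<close> per step on average; the factor
  \<open>1 / \<beta>\<close> pays for an unpaired step at odd \<open>r\<close>.\<close>

lemma alternating_average_bound:
  assumes \<beta>: "0 < \<beta>" "\<beta> < 1" and \<gamma>: "0 \<le> \<gamma>" "\<gamma> \<le> \<beta> ^ 4"
    and energy: "(\<Sum>e\<in>E. (alternating_average E S T r g e)\<^sup>2) \<le> \<gamma> ^ (r div 2) * (\<Sum>e\<in>E. (g e)\<^sup>2)"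
    and e: "e \<in> E"
  shows "\<bar>alternating_average E S T r g e\<bar> \<le> edge_norm E g * \<beta> ^ r / \<beta>"
proof -
  let ?k = "r div 2"
  have "\<gamma> ^ ?k \<le> (\<beta> ^ 4) ^ ?k" using \<gamma> by (intro power_mono)
  also have "\<dots> = (\<beta> ^ (2 * ?k))\<^sup>2" by (simp add: power_mult[symmetric])
  finally have \<gamma>k: "\<gamma> ^ ?k \<le> (\<beta> ^ (2 * ?k))\<^sup>2" .
  have "\<beta> * \<beta> ^ (2 * ?k) = \<beta> ^ Suc (2 * ?k)" by simp
  also have "\<dots> \<le> \<beta> ^ r" using \<beta> by (intro power_decreasing) auto
  finally have \<beta>k: "\<beta> ^ (2 * ?k) \<le> \<beta> ^ r / \<beta>" using \<beta> by (simp add: field_simps)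
  have "(\<Sum>e\<in>E. (alternating_average E S T r g e)\<^sup>2) \<le> (\<beta> ^ (2 * ?k))\<^sup>2 * (\<Sum>e\<in>E. (g e)\<^sup>2)"
    using energy mult_right_mono[OF \<gamma>k, of "\<Sum>e\<in>E. (g e)\<^sup>2"] by (simp add: sum_nonneg)
  then have "edge_norm E (alternating_average E S T r g) \<le> sqrt ((\<beta> ^ (2 * ?k))\<^sup>2 * (\<Sum>e\<in>E. (g e)\<^sup>2))"
    unfolding edge_norm_eq by (rule real_sqrt_le_mono)
  also have "\<dots> = \<beta> ^ (2 * ?k) * edge_norm E g"
    using \<beta> by (simp add: edge_norm_eq real_sqrt_mult)
  also have "\<dots> \<le> \<beta> ^ r / \<beta> * edge_norm E g"
    using \<beta>k edge_norm_nonneg by (rule mult_right_mono)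
  finally show ?thesis
    using abs_le_edge_norm[OF finite_E e, of "alternating_average E S T r g"] by (simp add: mult.commute)
qed

end

section \<open>Arcs and tubes of the covering tree\<close>

context universal_cover
begin

lemma bij_betw_projected_edges:
  assumes G: "biregular_graph V E S T p q"
    and a: "{w', w} \<in> CE" and S: "last w \<in> S"
  shows "bij_betw (\<lambda>z. {last w, last z}) {z. {w, z} \<in> CE \<and> z \<noteq> w'}
    {e\<in>E. e \<inter> S = {last w', last w} \<inter> S \<and> e \<noteq> {last w', last w}}"
proof -
  interpret G: biregular_graph V E S T p q by fact
  have aE: "{last w', last w} \<in> E" using cover_edge_project[OF a] .
  have aS: "{last w', last w} \<inter> S = {last w}" using G.edge_Int_side[OF aE S] by simp
  have a': "{w, w'} \<in> CE" using a by (simp add: insert_commute)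
  have w: "w \<in> CV" using a by (simp add: cover_edge_iff)
  have inj: "y = z" if "{w, y} \<in> CE" "{w, z} \<in> CE" "{last w, last y} = {last w, last z}" for y z
    proof -
    have "last y = last z" using that(3) unfolding doubleton_eq_iff by argo
    then show ?thesis by (rule last_inj_on_neighbours[OF that(1,2)])
  qed
  show ?thesis unfolding aS
  proof (rule bij_betw_imageI)
    show "inj_on (\<lambda>z. {last w, last z}) {z. {w, z} \<in> CE \<and> z \<noteq> w'}"
      using inj by (intro inj_onI) blast
    show "(\<lambda>z. {last w, last z}) ` {z. {w, z} \<in> CE \<and> z \<noteq> w'}
        = {e\<in>E. e \<inter> S = {last w} \<and> e \<noteq> {last w', last w}}"
    proof (intro subset_antisym subsetI)
      fix e assume "e \<in> (\<lambda>z. {last w, last z}) ` {z. {w, z} \<in> CE \<and> z \<noteq> w'}"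
      then obtain z where z: "e = {last w, last z}" "{w, z} \<in> CE" "z \<noteq> w'" by blast
      then have "e \<in> E" using cover_edge_project by blast
      moreover have "e \<noteq> {last w', last w}"
        using inj[OF z(2) a'] z by (auto simp: insert_commute)
      moreover have "e \<inter> S = {last w}" using G.edge_Int_side[OF \<open>e \<in> E\<close> S] z by simp
      ultimately show "e \<in> {e\<in>E. e \<inter> S = {last w} \<and> e \<noteq> {last w', last w}}" by blast
    next
      fix e assume "e \<in> {e\<in>E. e \<inter> S = {last w} \<and> e \<noteq> {last w', last w}}"
      then have e: "e \<in> E" "e \<inter> S = {last w}" "e \<noteq> {last w', last w}" by auto
      have "last w \<in> e" using e(2) by blast
      then obtain v where v: "e = {last w, v}" using G.edge_parts[OF e(1)] by fast
      then obtain z where z: "{w, z} \<in> CE" "last z = v" using neighbour_lift[OF w] e by blast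
      then have "z \<noteq> w'" using e v by (auto simp: insert_commute)
      then show "e \<in> (\<lambda>z. {last w, last z}) ` {z. {w, z} \<in> CE \<and> z \<noteq> w'}"
        using z v by blast
    qed
  qed
qed

text \<open>Decompose the arc by its first step. The continuations of the directed edge project bijectively onto the other
  edges at the target of its projection, which are the edges that the outermost averaging operator sees.\<close>

lemma arc_sum:
  assumes "biregular_graph V E S T p q" "{w', w} \<in> CE" "last w \<in> S"
  shows "finite (edge_arc CV CE r w' w) \<and> (\<Sum>e\<in>edge_arc CV CE r w' w. lift f e)
    = arc_size p q r * alternating_average E S T r f {last w', last w}"
  using assms
proof (induction r arbitrary: S T p q w' w)
  case 0
  then show ?case by (simp add: lift_def)
next
  case (Suc r)
  interpret G: biregular_graph V E S T p q by (rule Suc.prems(1))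
  interpret e: equipartition E "\<lambda>e. e \<inter> S" p by (rule G.equipartition_side)
  define N where "N = {z. {w, z} \<in> CE \<and> z \<noteq> w'}"
  define P where "P = {e\<in>E. e \<inter> S = {last w', last w} \<inter> S \<and> e \<noteq> {last w', last w}}"
  define g where "g = alternating_average E T S r f"
  have bij: "bij_betw (\<lambda>z. {last w, last z}) N P"
    using bij_betw_projected_edges[OF Suc.prems] by (simp add: N_def P_def)
  have cardP: "card P = p"
    using e.card_others[OF cover_edge_project[OF Suc.prems(2)]] by (simp add: P_def)
  have "finite P" using G.finite_E by (simp add: P_def)
  then have finN: "finite N" using bij_betw_finite bij by blast
  have IH: "finite (edge_arc CV CE r w z)"
    "(\<Sum>e\<in>edge_arc CV CE r w z. lift f e) = arc_size q p r * g {last w, last z}" if "z \<in> N" for z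
  proof -
    have z: "{w, z} \<in> CE" using that by (simp add: N_def)
    then have "last z \<in> T" using G.edge_other_side cover_edge_project Suc.prems(3) by blast
    then show "finite (edge_arc CV CE r w z)"
      "(\<Sum>e\<in>edge_arc CV CE r w z. lift f e) = arc_size q p r * g {last w, last z}"
      using Suc.IH[OF biregular_graph_swap[OF Suc.prems(1)] z] by (simp_all add: g_def)
  qed
  have arc: "edge_arc CV CE (Suc r) w' w = (\<Union>z\<in>N. edge_arc CV CE r w z)"
    unfolding N_def by (rule tree.edge_arc_Suc[OF Suc.prems(2)])
  have "(\<Sum>e\<in>edge_arc CV CE (Suc r) w' w. lift f e) = (\<Sum>z\<in>N. \<Sum>e\<in>edge_arc CV CE r w z. lift f e)"
    unfolding arc
  proof (rule sum.UNION_disjoint)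
    show "\<forall>z\<in>N. \<forall>z'\<in>N. z \<noteq> z' \<longrightarrow> edge_arc CV CE r w z \<inter> edge_arc CV CE r w z' = {}"
      using tree.edge_arc_disjoint by (simp add: N_def)
  qed (use finN IH in auto)
  also have "\<dots> = (\<Sum>z\<in>N. arc_size q p r * g {last w, last z})"
    by (intro sum.cong refl IH)
  also have "\<dots> = (\<Sum>e\<in>P. arc_size q p r * g e)"
    by (rule sum.reindex_bij_betw[OF bij])
  also have "\<dots> = arc_size p q (Suc r) * star_average E (\<lambda>e. e \<inter> S) g {last w', last w}"
    using cardP G.p_ge_2
    by (simp add: star_average_def average_def P_def[symmetric] sum_distrib_left[symmetric])
  finally have "(\<Sum>e\<in>edge_arc CV CE (Suc r) w' w. lift f e)
    = arc_size p q (Suc r) * alternating_average E S T (Suc r) f {last w', last w}"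
    by (simp add: g_def)
  moreover have "finite (edge_arc CV CE (Suc r) w' w)"
    unfolding arc using finN IH by blast
  ultimately show ?case by blast
qed

lemma finite_neighbours:
  assumes "finite V"
  shows "finite {z. {w, z} \<in> CE}"
proof (rule finite_imageD)
  have "last ` {z. {w, z} \<in> CE} \<subseteq> V"
    using last_cover_in by (auto simp: cover_edge_iff)
  then show "finite (last ` {z. {w, z} \<in> CE})" using assms finite_subset by blast
  show "inj_on last {z. {w, z} \<in> CE}"
    using last_inj_on_neighbours by (intro inj_onI) blast
qed

lemma arc_estimate:
  assumes G: "biregular_graph V E S T p q" and a: "{w', w} \<in> CE" and S: "last w \<in> S"
    and K: "\<And>e. e \<in> E \<Longrightarrow> \<bar>alternating_average E S T r g e\<bar> \<le> K"
  shows "finite (edge_arc CV CE r w' w)" "edge_arc CV CE r w' w \<noteq> {}"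
    "\<bar>\<Sum>e\<in>edge_arc CV CE r w' w. lift g e\<bar> \<le> K * real (card (edge_arc CV CE r w' w))"
proof -
  interpret G: biregular_graph V E S T p q by fact
  let ?A = "edge_arc CV CE r w' w"
  have E: "{last w', last w} \<in> E" using cover_edge_project[OF a] .
  show "finite ?A" using arc_sum[OF G a S] by blast
  have "real (card ?A) = (\<Sum>e\<in>?A. lift (\<lambda>_. 1) e)" by (simp add: lift_def)
  then have card: "real (card ?A) = real (arc_size p q r)"
    using arc_sum[OF G a S] G.alternating_average_one[OF E] by simp
  then show "?A \<noteq> {}" using arc_size_pos[of p q r] G.p_ge_2 G.q_ge_2 by auto
  have "\<bar>\<Sum>e\<in>?A. lift g e\<bar> = real (card ?A) * \<bar>alternating_average E S T r g {last w', last w}\<bar>"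
    using arc_sum[OF G a S] card by (simp add: abs_mult)
  also have "\<dots> \<le> real (card ?A) * K" using K[OF E] by (intro mult_left_mono) auto
  finally show "\<bar>\<Sum>e\<in>?A. lift g e\<bar> \<le> K * real (card ?A)" by (simp add: mult.commute)
qed

lemma arc_deviation:
  assumes arc: "finite (edge_arc CV CE r w' w)" "edge_arc CV CE r w' w \<noteq> {}"
    "\<bar>\<Sum>e\<in>edge_arc CV CE r w' w. lift (\<lambda>e. f e - m) e\<bar> \<le> K * real (card (edge_arc CV CE r w' w))" and "K \<ge> 0"
  shows "\<bar>arc_average V E root r w' w f - m\<bar> \<le> K"
  using abs_average_le[OF arc(3) assms(4)] average_minus_const[OF arc(1,2), of "lift f" m]
  by (simp add: arc_average_def lift_def)

text \<open>The sum over the tube is the sum over the boundary edges of sums over arcs, each at most \<open>K\<close> times the size of its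
  arc, and these sizes add up to the size of the tube. Since every vertex has two neighbours, the tube is
  not empty and subtracting \<open>m\<close> commutes with averaging.\<close>

lemma tube_deviation:
  assumes W: "subgraph W F CV CE" "connected_graph W F" "finite W" and "finite V"
    and two: "\<And>v. v \<in> V \<Longrightarrow> \<exists>a b. a \<noteq> b \<and> {v, a} \<in> E \<and> {v, b} \<in> E"
    and arc: "\<And>w' w. {w', w} \<in> CE \<Longrightarrow> finite (edge_arc CV CE (Suc r) w' w)"
      "\<And>w' w. {w', w} \<in> CE \<Longrightarrow> edge_arc CV CE (Suc r) w' w \<noteq> {}"
      "\<And>w' w. {w', w} \<in> CE \<Longrightarrow> \<bar>\<Sum>e\<in>edge_arc CV CE (Suc r) w' w. lift (\<lambda>e. f e - m) e\<bar>
        \<le> K * real (card (edge_arc CV CE (Suc r) w' w))"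
    and "K \<ge> 0"
  shows "\<bar>average (edge_tube CV CE (Suc r) W) (lift f) - m\<bar> \<le> K"
proof -
  define A where "A = (\<lambda>(w', w). edge_arc CV CE (Suc r) w' w)"
  let ?B = "tree.boundary W"
  have WV: "W \<subseteq> CV" "W \<noteq> {}" using W by (simp_all add: subgraph_def connected_graph_def)
  have BE: "{fst b, snd b} \<in> CE" if "b \<in> ?B" for b
    using that by (auto simp: tree.boundary_def)
  have tube: "edge_tube CV CE (Suc r) W = (\<Union>b\<in>?B. A b)"
    using tree.edge_tube_Suc[OF W] by (simp add: A_def split_def)
  have "?B \<subseteq> (SIGMA w:W. {z. {w, z} \<in> CE})" by (auto simp: tree.boundary_def)
  then have finB: "finite ?B"
    using W(3) finite_neighbours[OF assms(4)] by (meson finite_SigmaI finite_subset)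
  have finA: "\<forall>b\<in>?B. finite (A b)" using arc(1) BE by (auto simp: A_def split_def)
  have disj: "\<forall>b\<in>?B. \<forall>b'\<in>?B. b \<noteq> b' \<longrightarrow> A b \<inter> A b' = {}"
  proof (intro ballI impI)
    fix b b' assume "b \<in> ?B" "b' \<in> ?B" "b \<noteq> b'"
    then show "A b \<inter> A b' = {}"
      using tree.boundary_arcs_disjoint[OF W(1,2), of "fst b" "snd b" "fst b'" "snd b'" "Suc r"]
      by (simp add: A_def split_def prod_eq_iff del: edge_arc.simps)
  qed
  have "\<exists>y z. y \<noteq> z \<and> {x, y} \<in> CE \<and> {x, z} \<in> CE" if x: "x \<in> CV" for x
  proof -
    obtain a b where ab: "a \<noteq> b" "{last x, a} \<in> E" "{last x, b} \<in> E"
      using two[OF last_cover_in[OF x]] by blast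
    obtain y where "{x, y} \<in> CE" "last y = a" using neighbour_lift[OF x ab(2)] .
    moreover obtain z where "{x, z} \<in> CE" "last z = b" using neighbour_lift[OF x ab(3)] .
    ultimately show ?thesis using ab(1) by metis
  qed
  then have "?B \<noteq> {}" using tree.boundary_nonempty W(3) WV by blast
  then have ne: "edge_tube CV CE (Suc r) W \<noteq> {}" unfolding tube
    using arc(2) BE by (fastforce simp: A_def split_def)
  have fin: "finite (edge_tube CV CE (Suc r) W)" unfolding tube using finB finA by blast
  have "\<bar>\<Sum>e\<in>edge_tube CV CE (Suc r) W. lift (\<lambda>e. f e - m) e\<bar>
      = \<bar>\<Sum>b\<in>?B. \<Sum>e\<in>A b. lift (\<lambda>e. f e - m) e\<bar>"
    unfolding tube using sum.UNION_disjoint[OF finB finA disj, of "lift (\<lambda>e. f e - m)"] by simp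
  also have "\<dots> \<le> (\<Sum>b\<in>?B. \<bar>\<Sum>e\<in>A b. lift (\<lambda>e. f e - m) e\<bar>)" by (rule sum_abs)
  also have "\<dots> \<le> (\<Sum>b\<in>?B. K * real (card (A b)))"
    using arc(3) BE by (intro sum_mono) (simp add: A_def split_def)
  also have "\<dots> = K * real (card (edge_tube CV CE (Suc r) W))"
    unfolding tube using card_UN_disjoint[OF finB finA disj] by (simp add: sum_distrib_left)
  finally have "\<bar>average (edge_tube CV CE (Suc r) W) (lift (\<lambda>e. f e - m))\<bar> \<le> K"
    using assms(9) by (rule abs_average_le)
  then show ?thesis
    using average_minus_const[OF fin ne, of "lift f" m] by (simp add: lift_def)
qed

lemma edge_tube_project:
  assumes "e \<in> edge_tube CV CE r W"
  shows "last ` e \<in> E"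
proof -
  obtain x y where "e = {x, y}" "{x, y} \<in> CE" using assms by (auto simp: edge_tube_def)
  then show ?thesis using cover_edge_project by simp
qed

end

theorem corollary6:
  fixes p q :: nat and V :: "'a set" and E :: "'a set set"
  assumes "p \<ge> 2" and "q \<ge> 2" and "semiregular_graph p q V E"
  shows "\<exists>C::real. C > 0 \<and>
    (\<forall>f :: 'a set \<Rightarrow> real.
      \<exists>\<beta>\<in>{real (p * q) powr (- 1 / 2)} \<union> {real (p * q) powr (- 1 / 4)..<1}.
      \<forall>o\<^sub>G\<in>V.
        (\<forall>u v w' w r. {u, v} \<in> E \<longrightarrow> lifts_edge V E o\<^sub>G w' w u v \<longrightarrow>
          \<bar>arc_average V E o\<^sub>G r w' w f - average E f\<bar> \<le> C * edge_norm E f * \<beta> ^ r) \<and>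
        (\<forall>W F r. subgraph W F (cover_verts V E o\<^sub>G) (cover_edges V E o\<^sub>G) \<longrightarrow>
          finite W \<longrightarrow> connected_graph W F \<longrightarrow>
          \<bar>average (edge_tube (cover_verts V E o\<^sub>G) (cover_edges V E o\<^sub>G) r W) (lift f)
             - average E f\<bar> \<le> C * edge_norm E f * \<beta> ^ r))"
proof -
  obtain S T where G: "biregular_graph V E S T p q"
    using semiregular_imp_biregular assms by blast
  interpret G: biregular_graph V E S T p q by fact
  have G': "biregular_graph V E T S q p" using G by (rule biregular_graph_swap)
  interpret G': biregular_graph V E T S q p by fact
  obtain \<gamma>1 where \<gamma>1: "0 \<le> \<gamma>1" "\<gamma>1 < 1" "\<And>f r. (\<Sum>e\<in>E. f e) = 0 \<Longrightarrow>
    (\<Sum>e\<in>E. (alternating_average E S T r f e)\<^sup>2) \<le> \<gamma>1 ^ (r div 2) * (\<Sum>e\<in>E. (f e)\<^sup>2)"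
    using G.alternating_average_contraction by blast
  obtain \<gamma>2 where \<gamma>2: "0 \<le> \<gamma>2" "\<gamma>2 < 1" "\<And>f r. (\<Sum>e\<in>E. f e) = 0 \<Longrightarrow>
    (\<Sum>e\<in>E. (alternating_average E T S r f e)\<^sup>2) \<le> \<gamma>2 ^ (r div 2) * (\<Sum>e\<in>E. (f e)\<^sup>2)"
    using G'.alternating_average_contraction by blast
  \<comment> \<open>energy contracts by at most \<open>\<beta>\<^sup>4\<close> in two steps, and \<open>\<beta>\<close> lies in the prescribed interval\<close>
  define \<beta> where "\<beta> = max (real (p * q) powr (- 1 / 4)) (root 4 (max \<gamma>1 \<gamma>2))"
  have pq: "real (p * q) > 1"
  proof -
    have "2 * 2 \<le> p * q" using assms(1,2) by (rule mult_le_mono)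
    then have "1 < p * q" by linarith
    then show ?thesis by (metis of_nat_1 of_nat_less_iff)
  qed
  have \<beta>: "\<beta> \<in> {real (p * q) powr (- 1 / 4)..<1}"
    using pq \<gamma>1(1,2) \<gamma>2(1,2) by (auto simp: \<beta>_def powr_less_one)
  have "real (p * q) powr (- 1 / 4) > 0" using pq by (metis powr_gt_zero not_one_less_zero)
  then have \<beta>01: "0 < \<beta>" "\<beta> < 1" using \<beta> unfolding atLeastLessThan_iff by linarith+
  have "max \<gamma>1 \<gamma>2 = root 4 (max \<gamma>1 \<gamma>2) ^ 4" using \<gamma>1(1) by simp
  also have "\<dots> \<le> \<beta> ^ 4" using \<gamma>1(1) by (intro power_mono) (auto simp: \<beta>_def)
  finally have \<gamma>\<beta>: "\<gamma>1 \<le> \<beta> ^ 4" "\<gamma>2 \<le> \<beta> ^ 4" by simp_all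
  have main: "(\<forall>u v w' w r. {u, v} \<in> E \<longrightarrow> lifts_edge V E o\<^sub>G w' w u v \<longrightarrow>
          \<bar>arc_average V E o\<^sub>G r w' w f - average E f\<bar> \<le> (2 / \<beta>) * edge_norm E f * \<beta> ^ r) \<and>
        (\<forall>W F r. subgraph W F (cover_verts V E o\<^sub>G) (cover_edges V E o\<^sub>G) \<longrightarrow>
          finite W \<longrightarrow> connected_graph W F \<longrightarrow>
          \<bar>average (edge_tube (cover_verts V E o\<^sub>G) (cover_edges V E o\<^sub>G) r W) (lift f)
             - average E f\<bar> \<le> (2 / \<beta>) * edge_norm E f * \<beta> ^ r)"
    for f :: "'a set \<Rightarrow> real" and o\<^sub>G
  proof -
    interpret universal_cover V E o\<^sub>G by (rule G.universal_cover)
    define g where "g = (\<lambda>e. f e - average E f)"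
    have g0: "(\<Sum>e\<in>E. g e) = 0" unfolding g_def by (rule sum_centred[OF G.finite_E])
    define K where "K = (\<lambda>r. (2 / \<beta>) * edge_norm E f * \<beta> ^ r)"
    have K0: "K r \<ge> 0" for r using \<beta>01 edge_norm_nonneg[of E f] by (simp add: K_def)
    have gK: "edge_norm E g * \<beta> ^ r / \<beta> \<le> K r" for r
    proof -
      have "edge_norm E g * \<beta> ^ r / \<beta> \<le> edge_norm E f * \<beta> ^ r / \<beta>"
        using edge_norm_centred[OF G.finite_E, of f] \<beta>01
        by (intro divide_right_mono mult_right_mono) (auto simp: g_def)
      also have "\<dots> \<le> 2 * (edge_norm E f * \<beta> ^ r / \<beta>)"
      proof -
        have "0 \<le> edge_norm E f * \<beta> ^ r / \<beta>" using \<beta>01 edge_norm_nonneg[of E f] by simp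
        then show ?thesis by linarith
      qed
      finally show ?thesis by (simp add: K_def)
    qed
    have arc: "finite (edge_arc CV CE r w' w) \<and> edge_arc CV CE r w' w \<noteq> {} \<and>
      \<bar>\<Sum>e\<in>edge_arc CV CE r w' w. lift g e\<bar> \<le> K r * card (edge_arc CV CE r w' w)"
      if a: "{w', w} \<in> CE" for w' w r
    proof -
      have "last w \<in> S \<or> last w \<in> T"
        using cover_edge_project[OF a] G.edge_in_V G.parts(1) by blast
      then show ?thesis
      proof
        assume S: "last w \<in> S"
        have "\<bar>alternating_average E S T r g e\<bar> \<le> K r" if "e \<in> E" for e
          using G.alternating_average_bound[OF \<beta>01 \<gamma>1(1) \<gamma>\<beta>(1) \<gamma>1(3)[OF g0] that] gK by (rule order_trans)
        then show ?thesis using arc_estimate[OF G a S] by blast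
      next
        assume T: "last w \<in> T"
        have "\<bar>alternating_average E T S r g e\<bar> \<le> K r" if "e \<in> E" for e
          using G'.alternating_average_bound[OF \<beta>01 \<gamma>2(1) \<gamma>\<beta>(2) \<gamma>2(3)[OF g0] that] gK by (rule order_trans)
        then show ?thesis using arc_estimate[OF G' a T] by blast
      qed
    qed
    have arcs: "\<bar>arc_average V E o\<^sub>G r w' w f - average E f\<bar> \<le> K r"
      if "lifts_edge V E o\<^sub>G w' w u v" for w' w u v r
    proof -
      have "{w', w} \<in> CE" using that by (simp add: lifts_edge_def)
      then show ?thesis using arc[of w' w r] arc_deviation[of r w' w f "average E f"] K0 by (simp add: g_def)
    qed
    \<comment> \<open>a tube of radius \<open>0\<close> also contains the edges of the subgraph, which lie in no arc leaving it; the factor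
      \<open>2\<close> in the constant \<open>2 / \<beta>\<close> is for this case\<close>
    have tubes: "\<bar>average (edge_tube CV CE r W) (lift f) - average E f\<bar> \<le> K r"
      if W: "subgraph W F CV CE" "finite W" "connected_graph W F" for W F r
    proof (cases r)
      case 0
      have "\<bar>\<Sum>e\<in>edge_tube CV CE r W. lift f e\<bar> \<le> edge_norm E f * card (edge_tube CV CE r W)"
        using abs_le_edge_norm[OF G.finite_E] edge_tube_project
        by (intro abs_sum_le_card) (simp add: lift_def)
      then have "\<bar>average (edge_tube CV CE r W) (lift f)\<bar> \<le> edge_norm E f"
        using edge_norm_nonneg by (rule abs_average_le)
      moreover have "\<bar>\<Sum>e\<in>E. f e\<bar> \<le> edge_norm E f * card E"
        using abs_le_edge_norm[OF G.finite_E] by (intro abs_sum_le_card)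
      then have "\<bar>average E f\<bar> \<le> edge_norm E f"
        using edge_norm_nonneg by (rule abs_average_le)
      moreover have "2 * edge_norm E f \<le> K r"
        using \<beta>01 edge_norm_nonneg[of E f] 0 by (simp add: K_def field_simps mult_left_le_one_le)
      ultimately show ?thesis by linarith
    next
      case (Suc n)
      show ?thesis
      proof (cases "E = {}")
        case True
        then have "edge_tube CV CE r W = {}" using edge_tube_project by blast
        then show ?thesis using True K0 by (simp add: average_def)
      next
        case False
        show ?thesis unfolding Suc
          using arc K0 by (intro tube_deviation[OF W(1,3,2) G.finite_V G.two_neighbours[OF False]])
            (simp_all add: g_def del: edge_arc.simps)
      qed
    qed
    show ?thesis using arcs tubes by (simp add: K_def)
  qed
  show ?thesis
  proof (intro exI[of _ "2 / \<beta>"] conjI allI bexI[of _ \<beta>] ballI)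
    show "2 / \<beta> > 0" using \<beta>01 by simp
    show "\<beta> \<in> {real (p * q) powr (- 1 / 2)} \<union> {real (p * q) powr (- 1 / 4)..<1}" using \<beta> by blast
  qed (use main in \<open>blast+\<close>)
qed

end
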